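(* Let $\Bbbk$ be a field, and let $(\lambda_{ij})_{1\le i,j\le n}$ be a skew-symmetric matrix over $\Bbbk$ (with zero diagonal) with $\lambda_{ij}\neq 0$ for all $i\ne j$. Let $A=\Bbbk_{\lambda_{ij}}[x_1,\dots,x_n]/M$, where $M$ is a graded Poisson ideal contained in $\Bbbk_{\lambda_{ij}}[x_1,\dots,x_n]_{\ge 3}$. Let $B=\Bbbk_{\lambda'_{ij}}[x_1,\dots,x_m]/N$ be another such graded Poisson algebra (with $(\lambda'_{ij})_{1\le i,j\le m}$ a skew-symmetric matrix with zero diagonal), where $N$ is a graded Poisson ideal contained in $\Bbbk_{\lambda'_{ij}}[x_1,\dots,x_m]_{\ge 2}$. If $A$ is isomorphic to $B$ as ungraded Poisson algebras, then $n=m$ and there is a permutation $\sigma\in S_n$ such that $\lambda_{ij}=\lambda'_{\sigma(i)\sigma(j)}$ for all $i,j$. Furthermore, after an elementary change of generators in $A$, $A=B$; that is, there are a permutation $\tau\in S_n$ and scalars $c_1,\dots,c_n\in\Bbbk^\times$ such that $x_i\mapsto c_ix_{\tau(i)}$ defines a Poisson algebra isomorphism $\Bbbk_{\lambda'_{ij}}[x_1,\dots,x_n]\to\Bbbk_{\lambda_{ij}}[x_1,\dots,x_n]$ carrying $N$ onto $M$.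
   Context: A Poisson algebra over $\Bbbk$ is a commutative $\Bbbk$-algebra with a $\Bbbk$-bilinear Lie bracket $\{\,,\}$ such that each $\{a,-\}$ is a $\Bbbk$-derivation. For a skew-symmetric matrix $(\lambda_{ij})$ over $\Bbbk$ with zero diagonal, the skew quadratic Poisson algebra $\Bbbk_{\lambda_{ij}}[x_1,\dots,x_n]$ is the polynomial algebra $\Bbbk[x_1,\dots,x_n]$, graded with $\deg x_i=1$, with Poisson bracket determined by $\{x_i,x_j\}=\lambda_{ij}x_ix_j$. The subscript $\ge r$ denotes the span of homogeneous elements of degree at least $r$. A Poisson ideal $I$ of $A$ is an ideal with $\{I,A\}\subseteq I$; it is graded if it is generated by homogeneous elements. Isomorphisms of Poisson algebras are bijective $\Bbbk$-algebra homomorphisms preserving brackets. *)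

theory Defs
  imports "HOL-Algebra.Algebra" "HOL-Algebra.Algebraic_Closure_Type" "HOL-Library.Poly_Mapping"
    "HOL-Combinatorics.Permutations"
begin

section \<open>Poisson algebras\<close>

record ('k, 'a) poisson = "('k, 'a) module" +
  pbracket :: "'a \<Rightarrow> 'a \<Rightarrow> 'a" ("(\<open>indent=1\<close>\<lbrace>_,/ _\<rbrace>\<index>)")

locale poisson_algebra = algebra K A
  for K :: "('k, 'm) ring_scheme" (structure) and A :: "('k, 'a, 'x) poisson_scheme" (structure) +
  assumes bracket_closed [simp, intro]:
      "\<lbrakk>a \<in> carrier A; b \<in> carrier A\<rbrakk> \<Longrightarrow> \<lbrace>a, b\<rbrace>\<^bsub>A\<^esub> \<in> carrier A"
    and bracket_add_left:
      "\<lbrakk>a \<in> carrier A; b \<in> carrier A; c \<in> carrier A\<rbrakk> \<Longrightarrow>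
        \<lbrace>a \<oplus>\<^bsub>A\<^esub> b, c\<rbrace>\<^bsub>A\<^esub> = \<lbrace>a, c\<rbrace>\<^bsub>A\<^esub> \<oplus>\<^bsub>A\<^esub> \<lbrace>b, c\<rbrace>\<^bsub>A\<^esub>"
    and bracket_add_right:
      "\<lbrakk>a \<in> carrier A; b \<in> carrier A; c \<in> carrier A\<rbrakk> \<Longrightarrow>
        \<lbrace>a, b \<oplus>\<^bsub>A\<^esub> c\<rbrace>\<^bsub>A\<^esub> = \<lbrace>a, b\<rbrace>\<^bsub>A\<^esub> \<oplus>\<^bsub>A\<^esub> \<lbrace>a, c\<rbrace>\<^bsub>A\<^esub>"
    and bracket_smult_left:
      "\<lbrakk>k \<in> carrier K; a \<in> carrier A; b \<in> carrier A\<rbrakk> \<Longrightarrow>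
        \<lbrace>k \<odot>\<^bsub>A\<^esub> a, b\<rbrace>\<^bsub>A\<^esub> = k \<odot>\<^bsub>A\<^esub> \<lbrace>a, b\<rbrace>\<^bsub>A\<^esub>"
    and bracket_smult_right:
      "\<lbrakk>k \<in> carrier K; a \<in> carrier A; b \<in> carrier A\<rbrakk> \<Longrightarrow>
        \<lbrace>a, k \<odot>\<^bsub>A\<^esub> b\<rbrace>\<^bsub>A\<^esub> = k \<odot>\<^bsub>A\<^esub> \<lbrace>a, b\<rbrace>\<^bsub>A\<^esub>"
    and bracket_self: "a \<in> carrier A \<Longrightarrow> \<lbrace>a, a\<rbrace>\<^bsub>A\<^esub> = \<zero>\<^bsub>A\<^esub>"
    and bracket_jacobi:
      "\<lbrakk>a \<in> carrier A; b \<in> carrier A; c \<in> carrier A\<rbrakk> \<Longrightarrow>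
        \<lbrace>a, \<lbrace>b, c\<rbrace>\<^bsub>A\<^esub>\<rbrace>\<^bsub>A\<^esub> \<oplus>\<^bsub>A\<^esub> \<lbrace>b, \<lbrace>c, a\<rbrace>\<^bsub>A\<^esub>\<rbrace>\<^bsub>A\<^esub> \<oplus>\<^bsub>A\<^esub> \<lbrace>c, \<lbrace>a, b\<rbrace>\<^bsub>A\<^esub>\<rbrace>\<^bsub>A\<^esub> = \<zero>\<^bsub>A\<^esub>"
    and bracket_leibniz:
      "\<lbrakk>a \<in> carrier A; b \<in> carrier A; c \<in> carrier A\<rbrakk> \<Longrightarrow>
        \<lbrace>a, b \<otimes>\<^bsub>A\<^esub> c\<rbrace>\<^bsub>A\<^esub> = \<lbrace>a, b\<rbrace>\<^bsub>A\<^esub> \<otimes>\<^bsub>A\<^esub> c \<oplus>\<^bsub>A\<^esub> b \<otimes>\<^bsub>A\<^esub> \<lbrace>a, c\<rbrace>\<^bsub>A\<^esub>"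

definition poisson_ideal :: "'a set \<Rightarrow> ('k, 'a, 'x) poisson_scheme \<Rightarrow> bool" where
  "poisson_ideal I A \<longleftrightarrow> ideal I A \<and> (\<forall>a\<in>I. \<forall>b\<in>carrier A. \<lbrace>a, b\<rbrace>\<^bsub>A\<^esub> \<in> I)"

definition poisson_quotient ::
    "('k, 'a, 'x) poisson_scheme \<Rightarrow> 'a set \<Rightarrow> ('k, 'a set) poisson" (infixl "QuotP" 65) where
  "A QuotP I =
    \<lparr>carrier = carrier (A Quot I), monoid.mult = (\<otimes>\<^bsub>A Quot I\<^esub>),
     one = \<one>\<^bsub>A Quot I\<^esub>, ring.zero = \<zero>\<^bsub>A Quot I\<^esub>, add = (\<oplus>\<^bsub>A Quot I\<^esub>),
     module.smult = (\<lambda>k U. \<Union>a\<in>U. I +>\<^bsub>A\<^esub> (k \<odot>\<^bsub>A\<^esub> a)),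
     pbracket = (\<lambda>U V. \<Union>a\<in>U. \<Union>b\<in>V. I +>\<^bsub>A\<^esub> \<lbrace>a, b\<rbrace>\<^bsub>A\<^esub>)\<rparr>"

definition poisson_hom ::
    "('k, 'm) ring_scheme \<Rightarrow> ('k, 'a, 'x) poisson_scheme \<Rightarrow> ('k, 'b, 'y) poisson_scheme \<Rightarrow> ('a \<Rightarrow> 'b) set"
  where
  "poisson_hom K A B = {h \<in> ring_hom A B.
     (\<forall>k\<in>carrier K. \<forall>a\<in>carrier A. h (k \<odot>\<^bsub>A\<^esub> a) = k \<odot>\<^bsub>B\<^esub> h a) \<and>
     (\<forall>a\<in>carrier A. \<forall>b\<in>carrier A. h \<lbrace>a, b\<rbrace>\<^bsub>A\<^esub> = \<lbrace>h a, h b\<rbrace>\<^bsub>B\<^esub>)}"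

definition poisson_iso ::
    "('k, 'm) ring_scheme \<Rightarrow> ('k, 'a, 'x) poisson_scheme \<Rightarrow> ('k, 'b, 'y) poisson_scheme \<Rightarrow> ('a \<Rightarrow> 'b) set"
  where
  "poisson_iso K A B = {h \<in> poisson_hom K A B. bij_betw h (carrier A) (carrier B)}"

lemma (in poisson_algebra) bracket_zero_right:
  assumes "a \<in> carrier A" shows "\<lbrace>a, \<zero>\<^bsub>A\<^esub>\<rbrace>\<^bsub>A\<^esub> = \<zero>\<^bsub>A\<^esub>"
  using bracket_add_right[of a "\<zero>\<^bsub>A\<^esub>" "\<zero>\<^bsub>A\<^esub>"] assms
  by (simp add: M.add.l_cancel_one')

lemma (in poisson_algebra) bracket_antisym:
  assumes "a \<in> carrier A" "b \<in> carrier A" shows "\<lbrace>a, b\<rbrace>\<^bsub>A\<^esub> = \<ominus>\<^bsub>A\<^esub> \<lbrace>b, a\<rbrace>\<^bsub>A\<^esub>"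
proof -
  have "\<zero>\<^bsub>A\<^esub> = \<lbrace>a \<oplus>\<^bsub>A\<^esub> b, a \<oplus>\<^bsub>A\<^esub> b\<rbrace>\<^bsub>A\<^esub>"
    using assms bracket_self by simp
  also have "\<dots> = (\<lbrace>a, a\<rbrace>\<^bsub>A\<^esub> \<oplus>\<^bsub>A\<^esub> \<lbrace>b, a\<rbrace>\<^bsub>A\<^esub>) \<oplus>\<^bsub>A\<^esub> (\<lbrace>a, b\<rbrace>\<^bsub>A\<^esub> \<oplus>\<^bsub>A\<^esub> \<lbrace>b, b\<rbrace>\<^bsub>A\<^esub>)"
    using assms by (simp only: bracket_add_left bracket_add_right M.a_closed)
  also have "\<dots> = \<lbrace>a, b\<rbrace>\<^bsub>A\<^esub> \<oplus>\<^bsub>A\<^esub> \<lbrace>b, a\<rbrace>\<^bsub>A\<^esub>"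
    using assms by (simp add: bracket_self M.a_comm)
  finally show ?thesis
    using M.minus_equality[of "\<lbrace>a, b\<rbrace>\<^bsub>A\<^esub>" "\<lbrace>b, a\<rbrace>\<^bsub>A\<^esub>"] assms by (metis bracket_closed)
qed

context poisson_algebra
begin

context
  fixes I assumes I: "poisson_ideal I A"
begin

interpretation I: ideal I A
  using I by (simp add: poisson_ideal_def)

lemma bracket_ideal_right:
  assumes "a \<in> carrier A" "b \<in> I" shows "\<lbrace>a, b\<rbrace>\<^bsub>A\<^esub> \<in> I"
proof -
  have "b \<in> carrier A" "\<lbrace>b, a\<rbrace>\<^bsub>A\<^esub> \<in> I"
    using I assms I.Icarr by (auto simp: poisson_ideal_def)
  then show ?thesis
    using bracket_antisym[of a b] assms I.a_inv_closed by simp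
qed

lemma smult_ideal:
  assumes "k \<in> carrier K" "b \<in> I" shows "k \<odot>\<^bsub>A\<^esub> b \<in> I"
proof -
  have b: "b \<in> carrier A" using assms I.Icarr by blast
  have "(k \<odot>\<^bsub>A\<^esub> \<one>\<^bsub>A\<^esub>) \<otimes>\<^bsub>A\<^esub> b \<in> I"
    using assms by (intro I.I_l_closed) auto
  then show ?thesis using assms b by (simp add: smult_assoc2)
qed

lemma coset_eqI:
  "\<lbrakk>i \<in> I; a \<in> carrier A\<rbrakk> \<Longrightarrow> I +>\<^bsub>A\<^esub> (i \<oplus>\<^bsub>A\<^esub> a) = I +>\<^bsub>A\<^esub> a"
  using I.a_repr_independence'[of "i \<oplus>\<^bsub>A\<^esub> a" a] by (auto simp: a_r_coset_def')

lemma smult_coset: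
  assumes "k \<in> carrier K" "a \<in> carrier A"
  shows "k \<odot>\<^bsub>A QuotP I\<^esub> (I +>\<^bsub>A\<^esub> a) = I +>\<^bsub>A\<^esub> (k \<odot>\<^bsub>A\<^esub> a)"
proof -
  have "I +>\<^bsub>A\<^esub> (k \<odot>\<^bsub>A\<^esub> x) = I +>\<^bsub>A\<^esub> (k \<odot>\<^bsub>A\<^esub> a)" if "x \<in> I +>\<^bsub>A\<^esub> a" for x
  proof -
    from that obtain i where i: "i \<in> I" "x = i \<oplus>\<^bsub>A\<^esub> a"
      by (auto simp: a_r_coset_def')
    then show ?thesis
      using assms I.Icarr by (simp add: smult_r_distr coset_eqI smult_ideal)
  qed
  then have "(\<Union>x\<in>I +>\<^bsub>A\<^esub> a. I +>\<^bsub>A\<^esub> (k \<odot>\<^bsub>A\<^esub> x)) = (\<Union>x\<in>I +>\<^bsub>A\<^esub> a. I +>\<^bsub>A\<^esub> (k \<odot>\<^bsub>A\<^esub> a))"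
    by (intro SUP_cong refl)
  then show ?thesis
    using I.a_rcos_self[OF assms(2)] by (simp only: poisson_quotient_def UN_constant) auto
qed

lemma bracket_coset:
  assumes "a \<in> carrier A" "b \<in> carrier A"
  shows "\<lbrace>I +>\<^bsub>A\<^esub> a, I +>\<^bsub>A\<^esub> b\<rbrace>\<^bsub>A QuotP I\<^esub> = I +>\<^bsub>A\<^esub> \<lbrace>a, b\<rbrace>\<^bsub>A\<^esub>"
proof -
  have "I +>\<^bsub>A\<^esub> \<lbrace>x, y\<rbrace>\<^bsub>A\<^esub> = I +>\<^bsub>A\<^esub> \<lbrace>a, b\<rbrace>\<^bsub>A\<^esub>" if "x \<in> I +>\<^bsub>A\<^esub> a" "y \<in> I +>\<^bsub>A\<^esub> b" for x y
  proof -
    from that obtain i j where i: "i \<in> I" "x = i \<oplus>\<^bsub>A\<^esub> a" and j: "j \<in> I" "y = j \<oplus>\<^bsub>A\<^esub> b"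
      by (auto simp: a_r_coset_def')
    have c: "i \<in> carrier A" "j \<in> carrier A" "y \<in> carrier A"
      using i j I.Icarr assms by auto
    have "\<lbrace>x, y\<rbrace>\<^bsub>A\<^esub> = \<lbrace>i, y\<rbrace>\<^bsub>A\<^esub> \<oplus>\<^bsub>A\<^esub> (\<lbrace>a, j\<rbrace>\<^bsub>A\<^esub> \<oplus>\<^bsub>A\<^esub> \<lbrace>a, b\<rbrace>\<^bsub>A\<^esub>)"
      using c assms by (simp add: i(2) bracket_add_left) (simp add: j(2) bracket_add_right)
    moreover have "\<lbrace>i, y\<rbrace>\<^bsub>A\<^esub> \<in> I" "\<lbrace>a, j\<rbrace>\<^bsub>A\<^esub> \<in> I"
      using I i c j assms bracket_ideal_right by (auto simp: poisson_ideal_def)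
    ultimately show ?thesis
      using assms c by (simp only: coset_eqI M.a_closed I.Icarr bracket_closed)
  qed
  then have "(\<Union>x\<in>I +>\<^bsub>A\<^esub> a. \<Union>y\<in>I +>\<^bsub>A\<^esub> b. I +>\<^bsub>A\<^esub> \<lbrace>x, y\<rbrace>\<^bsub>A\<^esub>) =
      (\<Union>x\<in>I +>\<^bsub>A\<^esub> a. \<Union>y\<in>I +>\<^bsub>A\<^esub> b. I +>\<^bsub>A\<^esub> \<lbrace>a, b\<rbrace>\<^bsub>A\<^esub>)"
    by (intro SUP_cong refl)
  then show ?thesis
    using I.a_rcos_self[OF assms(1)] I.a_rcos_self[OF assms(2)]
    by (simp only: poisson_quotient_def UN_constant) auto
qed

lemma poisson_quotient_poisson_algebra: "poisson_algebra K (A QuotP I)"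
proof -
  let ?Q = "A QuotP I"
  have cr: "cring (A Quot I)"
    using I.quotient_is_cring M_cring by blast
  interpret Q: cring "A Quot I" by (rule cr)
  have simps: "carrier ?Q = carrier (A Quot I)" "monoid.mult ?Q = monoid.mult (A Quot I)"
    "\<one>\<^bsub>?Q\<^esub> = \<one>\<^bsub>A Quot I\<^esub>" "\<zero>\<^bsub>?Q\<^esub> = \<zero>\<^bsub>A Quot I\<^esub>" "ring.add ?Q = ring.add (A Quot I)"
    by (simp_all add: poisson_quotient_def)
  have crQ: "cring ?Q"
  proof (rule cringI)
    show "abelian_group ?Q"
    proof (rule abelian_groupI, unfold simps)
      show "\<exists>y\<in>carrier (A Quot I). y \<oplus>\<^bsub>A Quot I\<^esub> x = \<zero>\<^bsub>A Quot I\<^esub>" if "x \<in> carrier (A Quot I)" for x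
        using that Q.l_neg Q.a_inv_closed by blast
    qed (rule Q.a_closed Q.zero_closed Q.a_assoc Q.a_comm Q.l_zero; assumption)+
    show "comm_monoid ?Q"
      by (rule comm_monoidI, unfold simps) (rule Q.m_closed Q.one_closed Q.m_assoc Q.m_comm Q.l_one; assumption)+
  qed (simp add: simps Q.l_distr)
  have carrE: thesis
    if "U \<in> carrier ?Q" "\<And>a. a \<in> carrier A \<Longrightarrow> U = I +>\<^bsub>A\<^esub> a \<Longrightarrow> thesis" for U thesis
    using that by (auto simp: poisson_quotient_def FactRing_def A_RCOSETS_def')
  have carrI: "I +>\<^bsub>A\<^esub> a \<in> carrier ?Q" if "a \<in> carrier A" for a
    using that by (auto simp: poisson_quotient_def FactRing_def A_RCOSETS_def')
  have add: "(I +>\<^bsub>A\<^esub> a) \<oplus>\<^bsub>?Q\<^esub> (I +>\<^bsub>A\<^esub> b) = I +>\<^bsub>A\<^esub> (a \<oplus>\<^bsub>A\<^esub> b)"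
    if "a \<in> carrier A" "b \<in> carrier A" for a b
    using that by (simp add: poisson_quotient_def FactRing_def I.a_rcos_sum)
  have mult: "(I +>\<^bsub>A\<^esub> a) \<otimes>\<^bsub>?Q\<^esub> (I +>\<^bsub>A\<^esub> b) = I +>\<^bsub>A\<^esub> (a \<otimes>\<^bsub>A\<^esub> b)"
    if "a \<in> carrier A" "b \<in> carrier A" for a b
    using that by (simp add: poisson_quotient_def FactRing_def I.rcoset_mult_add)
  have zero: "\<zero>\<^bsub>?Q\<^esub> = I +>\<^bsub>A\<^esub> \<zero>\<^bsub>A\<^esub>"
    using I.a_rcos_const[OF I.zero_closed] by (simp add: poisson_quotient_def FactRing_def)
  note R = add mult zero carrI smult_coset bracket_coset
  show ?thesis
  proof (intro poisson_algebra.intro algebraI poisson_algebra_axioms.intro R_cring crQ)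
  qed ((elim carrE)?; simp add: R smult_l_distr smult_r_distr smult_assoc1 smult_assoc2
      bracket_add_left bracket_add_right bracket_smult_left bracket_smult_right
      bracket_self bracket_jacobi bracket_leibniz)+
qed

end

end

section \<open>Skew quadratic Poisson algebras\<close>

text \<open>A monomial \<open>x\<^sub>1\<^sup>a\<^sup>(\<^sup>1\<^sup>) \<cdots> x\<^sub>n\<^sup>a\<^sup>(\<^sup>n\<^sup>)\<close> is its finitely supported exponent function
  \<open>a\<close>, and a polynomial is a finitely supported function from monomials to coefficients;
  multiplication is convolution.\<close>

type_synonym 'k mpoly = "(nat \<Rightarrow>\<^sub>0 nat) \<Rightarrow>\<^sub>0 'k"

abbreviation scalars :: "'k::field ring" where
  "scalars \<equiv> ring_of_type_algebra"

definition Const :: "'k::field \<Rightarrow> 'k mpoly" where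
  "Const c = Poly_Mapping.single 0 c"

definition Var :: "nat \<Rightarrow> 'k::field mpoly" where
  "Var i = Poly_Mapping.single (Poly_Mapping.single i 1) 1"

definition polys :: "nat \<Rightarrow> 'k::field mpoly set" where
  "polys n = {p. \<forall>a\<in>Poly_Mapping.keys p. Poly_Mapping.keys a \<subseteq> {1..n}}"

text \<open>Where \<^term>\<open>Poly_Mapping.lookup a i = 0\<close>, the truncated difference of exponents is harmless
  because the coefficient vanishes.\<close>

definition partial :: "nat \<Rightarrow> 'k::field mpoly \<Rightarrow> 'k mpoly" where
  "partial i p = (\<Sum>a\<in>Poly_Mapping.keys p. Poly_Mapping.single (a - Poly_Mapping.single i 1)
     (of_nat (Poly_Mapping.lookup a i) * Poly_Mapping.lookup p a))"

text \<open>The biderivation with \<open>{x\<^sub>i, x\<^sub>j} = \<lambda>\<^sub>i\<^sub>j x\<^sub>i x\<^sub>j\<close>; see \<open>skew_bracket_Var\<close> and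
  \<open>skew_bracket_unique\<close> below.\<close>

definition skew_bracket ::
    "nat \<Rightarrow> (nat \<Rightarrow> nat \<Rightarrow> 'k::field) \<Rightarrow> 'k mpoly \<Rightarrow> 'k mpoly \<Rightarrow> 'k mpoly" where
  "skew_bracket n \<Lambda> p q =
     (\<Sum>i\<in>{1..n}. \<Sum>j\<in>{1..n}. Const (\<Lambda> i j) * Var i * Var j * partial i p * partial j q)"

definition skew_quadratic ::
    "nat \<Rightarrow> (nat \<Rightarrow> nat \<Rightarrow> 'k::field) \<Rightarrow> ('k, 'k mpoly) poisson" where
  "skew_quadratic n \<Lambda> =
    \<lparr>carrier = polys n, monoid.mult = (*), one = 1, ring.zero = 0, add = (+),
     module.smult = (\<lambda>c p. Const c * p), pbracket = skew_bracket n \<Lambda>\<rparr>"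

definition skew_matrix :: "nat \<Rightarrow> (nat \<Rightarrow> nat \<Rightarrow> 'k::field) \<Rightarrow> bool" where
  "skew_matrix n \<Lambda> \<longleftrightarrow>
    (\<forall>i\<in>{1..n}. \<forall>j\<in>{1..n}. \<Lambda> i j = - \<Lambda> j i) \<and> (\<forall>i\<in>{1..n}. \<Lambda> i i = 0)"

definition mon_deg :: "(nat \<Rightarrow>\<^sub>0 nat) \<Rightarrow> nat" where
  "mon_deg a = (\<Sum>i\<in>Poly_Mapping.keys a. Poly_Mapping.lookup a i)"

definition homogeneous :: "nat \<Rightarrow> 'k::field mpoly \<Rightarrow> bool" where
  "homogeneous d p \<longleftrightarrow> (\<forall>a\<in>Poly_Mapping.keys p. mon_deg a = d)"

text \<open>The span of the homogeneous elements of degree at least \<open>r\<close>; scalars may be omitted from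
  the sums because the set of these elements is closed under scalar multiplication.\<close>

definition polys_ge :: "nat \<Rightarrow> nat \<Rightarrow> 'k::field mpoly set" where
  "polys_ge n r = {\<Sum>f\<in>F. f | F. finite F \<and> F \<subseteq> {f \<in> polys n. \<exists>d\<ge>r. homogeneous d f}}"

definition graded_poisson_ideal ::
    "'k::field mpoly set \<Rightarrow> ('k, 'k mpoly, 'x) poisson_scheme \<Rightarrow> bool" where
  "graded_poisson_ideal I A \<longleftrightarrow> poisson_ideal I A \<and>
     (\<exists>S \<subseteq> {f \<in> carrier A. \<exists>d. homogeneous d f}. I = Idl\<^bsub>A\<^esub> S)"


lemma scalars_simps [simp]:
  "carrier scalars = UNIV" "x \<otimes>\<^bsub>scalars\<^esub> y = x * y" "\<one>\<^bsub>scalars\<^esub> = 1" "\<zero>\<^bsub>scalars\<^esub> = 0"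
  "x \<oplus>\<^bsub>scalars\<^esub> y = x + y"
  by (simp_all add: ring_of_type_algebra_def)

lemma skew_quadratic_simps [simp]:
  "carrier (skew_quadratic n \<Lambda>) = polys n"
  "p \<otimes>\<^bsub>skew_quadratic n \<Lambda>\<^esub> q = p * q" "\<one>\<^bsub>skew_quadratic n \<Lambda>\<^esub> = 1" "\<zero>\<^bsub>skew_quadratic n \<Lambda>\<^esub> = 0"
  "p \<oplus>\<^bsub>skew_quadratic n \<Lambda>\<^esub> q = p + q" "c \<odot>\<^bsub>skew_quadratic n \<Lambda>\<^esub> p = Const c * p"
  "\<lbrace>p, q\<rbrace>\<^bsub>skew_quadratic n \<Lambda>\<^esub> = skew_bracket n \<Lambda> p q"
  by (simp_all add: skew_quadratic_def)

lemma polys_single: "Poly_Mapping.keys a \<subseteq> {1..n} \<Longrightarrow> Poly_Mapping.single a c \<in> polys n"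
  by (simp add: polys_def)

lemma polys_add: "p \<in> polys n \<Longrightarrow> q \<in> polys n \<Longrightarrow> p + q \<in> polys n"
  using keys_add[of p q] unfolding polys_def by blast

lemma polys_uminus: "p \<in> polys n \<Longrightarrow> - p \<in> polys n"
  by (simp add: polys_def in_keys_iff)

lemma polys_mult:
  assumes "p \<in> polys n" "q \<in> polys n" shows "p * q \<in> polys n"
  unfolding polys_def
proof (intro CollectI ballI)
  fix a assume "a \<in> Poly_Mapping.keys (p * q)"
  then obtain b c where "a = b + c" "b \<in> Poly_Mapping.keys p" "c \<in> Poly_Mapping.keys q"
    using keys_mult[of p q] by blast
  then show "Poly_Mapping.keys a \<subseteq> {1..n}"
    using keys_add[of b c] assms unfolding polys_def by blast
qed

lemma polys_basic: "0 \<in> polys n" "1 \<in> polys n" "Const c \<in> polys n"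
  by (simp_all add: polys_def Const_def)

lemma polys_Var: "i \<in> {1..n} \<Longrightarrow> Var i \<in> polys n"
  unfolding Var_def by (rule polys_single) simp

lemmas polys_closed = polys_basic polys_Var polys_add polys_uminus polys_mult

lemma polys_sum: "(\<And>i. i \<in> I \<Longrightarrow> f i \<in> polys n) \<Longrightarrow> (\<Sum>i\<in>I. f i) \<in> polys n"
  by (induction I rule: infinite_finite_induct) (auto intro: polys_closed)

lemma mpoly_induct [case_names add single]:
  assumes "\<And>p q. P p \<Longrightarrow> P q \<Longrightarrow> P (p + q)" "\<And>a c. P (Poly_Mapping.single a c)"
  shows "P (p :: 'k::field mpoly)"
proof -
  have "P (\<Sum>a\<in>S. Poly_Mapping.single a (Poly_Mapping.lookup p a))" if "finite S" for S
    using that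
  proof induction
    case empty
    show ?case using assms(2)[of 0 0] by simp
  qed (use assms in auto)
  moreover have "(\<Sum>a\<in>Poly_Mapping.keys p. Poly_Mapping.single a (Poly_Mapping.lookup p a)) = p"
    by (rule poly_mapping_eqI)
      (simp add: lookup_sum lookup_single when_def in_keys_iff)
  ultimately show ?thesis using finite_keys by metis
qed

lemma partial_superset:
  assumes "finite S" "Poly_Mapping.keys p \<subseteq> S"
  shows "partial i p = (\<Sum>a\<in>S. Poly_Mapping.single (a - Poly_Mapping.single i 1)
     (of_nat (Poly_Mapping.lookup a i) * Poly_Mapping.lookup p a))"
  unfolding partial_def using assms by (intro sum.mono_neutral_left) (auto simp: in_keys_iff)

lemma partial_add: "partial i (p + q) = partial i p + partial i q"
  using keys_add[of p q]
  by (simp add: partial_superset[of "Poly_Mapping.keys p \<union> Poly_Mapping.keys q"]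
      lookup_add distrib_left single_add sum.distrib)

lemma partial_single:
  "partial i (Poly_Mapping.single a c) =
    Poly_Mapping.single (a - Poly_Mapping.single i 1) (of_nat (Poly_Mapping.lookup a i) * c)"
  by (subst partial_superset[of "{a}"]) auto

lemma Var_mult_partial_single:
  "Var i * partial i (Poly_Mapping.single a c) =
    Poly_Mapping.single a (of_nat (Poly_Mapping.lookup a i) * c)"
proof (cases "Poly_Mapping.lookup a i = 0")
  case False
  then have "Poly_Mapping.single i 1 + (a - Poly_Mapping.single i 1) = a"
    by (intro poly_mapping_eqI) (auto simp: lookup_add lookup_minus lookup_single when_def)
  then show ?thesis by (simp add: Var_def partial_single mult_single)
qed (simp add: partial_single)

lemma skew_bracket_add_left:
  "skew_bracket n \<Lambda> (p + q) r = skew_bracket n \<Lambda> p r + skew_bracket n \<Lambda> q r"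
  by (simp add: skew_bracket_def partial_add algebra_simps sum.distrib)

lemma skew_bracket_add_right:
  "skew_bracket n \<Lambda> r (p + q) = skew_bracket n \<Lambda> r p + skew_bracket n \<Lambda> r q"
  by (simp add: skew_bracket_def partial_add algebra_simps sum.distrib)

definition skew_form ::
    "nat \<Rightarrow> (nat \<Rightarrow> nat \<Rightarrow> 'k::field) \<Rightarrow> (nat \<Rightarrow>\<^sub>0 nat) \<Rightarrow> (nat \<Rightarrow>\<^sub>0 nat) \<Rightarrow> 'k" where
  "skew_form n \<Lambda> a b = (\<Sum>i\<in>{1..n}. \<Sum>j\<in>{1..n}.
     \<Lambda> i j * of_nat (Poly_Mapping.lookup a i) * of_nat (Poly_Mapping.lookup b j))"

lemma skew_form_add_left: "skew_form n \<Lambda> (a + b) c = skew_form n \<Lambda> a c + skew_form n \<Lambda> b c"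
  by (simp add: skew_form_def lookup_add algebra_simps sum.distrib)

lemma skew_form_add_right: "skew_form n \<Lambda> c (a + b) = skew_form n \<Lambda> c a + skew_form n \<Lambda> c b"
  by (simp add: skew_form_def lookup_add algebra_simps sum.distrib)

lemma single_sum: "Poly_Mapping.single a (\<Sum>i\<in>I. f i) = (\<Sum>i\<in>I. Poly_Mapping.single a (f i))"
  by (induction I rule: infinite_finite_induct) (auto simp: single_add)

lemma skew_bracket_single:
  "skew_bracket n \<Lambda> (Poly_Mapping.single a c) (Poly_Mapping.single b d) =
    Poly_Mapping.single (a + b) (skew_form n \<Lambda> a b * c * d)"
proof -
  have "Const (\<Lambda> i j) * Var i * Var j * partial i (Poly_Mapping.single a c) * partial j (Poly_Mapping.single b d) =
     Poly_Mapping.single (a + b) (\<Lambda> i j * of_nat (Poly_Mapping.lookup a i) * of_nat (Poly_Mapping.lookup b j) * c * d)"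
    for i j
  proof -
    have "Const (\<Lambda> i j) * Var i * Var j * partial i (Poly_Mapping.single a c) * partial j (Poly_Mapping.single b d) =
      Const (\<Lambda> i j) * (Var i * partial i (Poly_Mapping.single a c)) * (Var j * partial j (Poly_Mapping.single b d))"
      by (simp only: ac_simps)
    also have "\<dots> = Const (\<Lambda> i j) * (Poly_Mapping.single a (of_nat (Poly_Mapping.lookup a i) * c) *
        Poly_Mapping.single b (of_nat (Poly_Mapping.lookup b j) * d))"
      by (simp only: Var_mult_partial_single mult.assoc)
    finally show ?thesis by (simp add: Const_def mult_single mult_ac)
  qed
  then show ?thesis
    by (simp add: skew_bracket_def skew_form_def single_sum sum_distrib_right)
qed

lemma skew_form_swap:
  assumes "skew_matrix n \<Lambda>" shows "skew_form n \<Lambda> a b = - skew_form n \<Lambda> b a"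
proof -
  have "skew_form n \<Lambda> a b = (\<Sum>j\<in>{1..n}. \<Sum>i\<in>{1..n}.
     \<Lambda> i j * of_nat (Poly_Mapping.lookup a i) * of_nat (Poly_Mapping.lookup b j))"
    unfolding skew_form_def by (rule sum.swap)
  also have "\<dots> = (\<Sum>j\<in>{1..n}. \<Sum>i\<in>{1..n}.
     - (\<Lambda> j i * of_nat (Poly_Mapping.lookup b j) * of_nat (Poly_Mapping.lookup a i)))"
  proof (intro sum.cong refl)
    fix i j assume "i \<in> {1..n}" "j \<in> {1..n}"
    then have "\<Lambda> i j = - \<Lambda> j i" using assms unfolding skew_matrix_def by blast
    then show "\<Lambda> i j * of_nat (Poly_Mapping.lookup a i) * of_nat (Poly_Mapping.lookup b j) =
      - (\<Lambda> j i * of_nat (Poly_Mapping.lookup b j) * of_nat (Poly_Mapping.lookup a i))"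
      by (simp add: mult_ac)
  qed
  also have "\<dots> = - skew_form n \<Lambda> b a" by (simp add: skew_form_def sum_negf)
  finally show ?thesis .
qed

lemma skew_sum_zero:
  fixes f :: "nat \<Rightarrow> nat \<Rightarrow> 'r::comm_ring_1"
  assumes "\<And>i. i \<in> {1..n} \<Longrightarrow> f i i = 0"
    and "\<And>i j. i \<in> {1..n} \<Longrightarrow> j \<in> {1..n} \<Longrightarrow> f i j = - f j i"
  shows "(\<Sum>i\<in>{1..n}. \<Sum>j\<in>{1..n}. f i j) = 0"
  using assms
proof (induction n)
  case 0
  show ?case by simp
next
  case (Suc n)
  have 1: "(\<Sum>i\<in>{1..n}. f i (Suc n)) = (\<Sum>j\<in>{1..n}. - f (Suc n) j)"
    by (intro sum.cong refl Suc.prems(2)) auto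
  have 2: "(\<Sum>i\<in>{1..n}. \<Sum>j\<in>{1..n}. f i j) = 0"
    by (rule Suc.IH; rule Suc.prems) auto
  have 3: "f (Suc n) (Suc n) = 0"
    by (rule Suc.prems(1)) simp
  have "(\<Sum>i\<in>{1..Suc n}. \<Sum>j\<in>{1..Suc n}. f i j) =
    (\<Sum>i\<in>{1..n}. \<Sum>j\<in>{1..n}. f i j) + (\<Sum>i\<in>{1..n}. f i (Suc n)) + (\<Sum>j\<in>{1..n}. f (Suc n) j)
      + f (Suc n) (Suc n)"
    by (simp add: sum.distrib)
  also have "\<dots> = 0"
    unfolding 1 2 3 by (simp add: sum_negf)
  finally show ?case .
qed

lemma skew_bracket_self:
  assumes "skew_matrix n \<Lambda>" shows "skew_bracket n \<Lambda> p p = 0"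
  unfolding skew_bracket_def
proof (rule skew_sum_zero)
  fix i assume "i \<in> {1..n}"
  then have "\<Lambda> i i = 0" using assms unfolding skew_matrix_def by blast
  then show "Const (\<Lambda> i i) * Var i * Var i * partial i p * partial i p = 0"
    by (simp add: Const_def)
next
  fix i j assume "i \<in> {1..n}" "j \<in> {1..n}"
  then have "\<Lambda> i j = - \<Lambda> j i" using assms unfolding skew_matrix_def by blast
  then have "Const (\<Lambda> i j) = - Const (\<Lambda> j i)" by (simp add: Const_def single_uminus)
  then show "Const (\<Lambda> i j) * Var i * Var j * partial i p * partial j p =
    - (Const (\<Lambda> j i) * Var j * Var i * partial j p * partial i p)"
    by (simp add: mult_ac)
qed

lemma skew_bracket_leibniz:
  "skew_bracket n \<Lambda> p (q * r) = skew_bracket n \<Lambda> p q * r + q * skew_bracket n \<Lambda> p r"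
proof (induction p rule: mpoly_induct)
  case (single a c)
  show ?case
  proof (induction q rule: mpoly_induct)
    case (single b d)
    show ?case
    proof (induction r rule: mpoly_induct)
      case (single e f)
      show ?case
        by (simp add: mult_single skew_bracket_single skew_form_add_right single_add[symmetric]
            add_ac) (simp add: algebra_simps)
    qed (simp add: skew_bracket_add_right algebra_simps)
  qed (simp add: skew_bracket_add_right algebra_simps)
qed (simp add: skew_bracket_add_left algebra_simps)

lemma skew_bracket_jacobi:
  assumes "skew_matrix n \<Lambda>"
  shows "skew_bracket n \<Lambda> p (skew_bracket n \<Lambda> q r) + skew_bracket n \<Lambda> q (skew_bracket n \<Lambda> r p)
    + skew_bracket n \<Lambda> r (skew_bracket n \<Lambda> p q) = 0"
proof (induction p rule: mpoly_induct)
  case (add p p')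
  have "?case \<longleftrightarrow>
    (skew_bracket n \<Lambda> p (skew_bracket n \<Lambda> q r) + skew_bracket n \<Lambda> q (skew_bracket n \<Lambda> r p)
      + skew_bracket n \<Lambda> r (skew_bracket n \<Lambda> p q)) +
    (skew_bracket n \<Lambda> p' (skew_bracket n \<Lambda> q r) + skew_bracket n \<Lambda> q (skew_bracket n \<Lambda> r p')
      + skew_bracket n \<Lambda> r (skew_bracket n \<Lambda> p' q)) = 0"
    by (simp add: skew_bracket_add_left skew_bracket_add_right algebra_simps)
  with add show ?case by simp
next
  case (single a c)
  let ?p = "Poly_Mapping.single a c"
  show ?case
  proof (induction q rule: mpoly_induct)
    case (add q q')
    have "?case \<longleftrightarrow>
      (skew_bracket n \<Lambda> ?p (skew_bracket n \<Lambda> q r) + skew_bracket n \<Lambda> q (skew_bracket n \<Lambda> r ?p)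
        + skew_bracket n \<Lambda> r (skew_bracket n \<Lambda> ?p q)) +
      (skew_bracket n \<Lambda> ?p (skew_bracket n \<Lambda> q' r) + skew_bracket n \<Lambda> q' (skew_bracket n \<Lambda> r ?p)
        + skew_bracket n \<Lambda> r (skew_bracket n \<Lambda> ?p q')) = 0"
      by (simp add: skew_bracket_add_left skew_bracket_add_right algebra_simps)
    with add show ?case by simp
  next
    case (single b d)
    let ?q = "Poly_Mapping.single b d"
    show ?case
    proof (induction r rule: mpoly_induct)
      case (add r r')
      have "?case \<longleftrightarrow>
        (skew_bracket n \<Lambda> ?p (skew_bracket n \<Lambda> ?q r) + skew_bracket n \<Lambda> ?q (skew_bracket n \<Lambda> r ?p)
          + skew_bracket n \<Lambda> r (skew_bracket n \<Lambda> ?p ?q)) +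
        (skew_bracket n \<Lambda> ?p (skew_bracket n \<Lambda> ?q r') + skew_bracket n \<Lambda> ?q (skew_bracket n \<Lambda> r' ?p)
          + skew_bracket n \<Lambda> r' (skew_bracket n \<Lambda> ?p ?q)) = 0"
        by (simp only: skew_bracket_add_left skew_bracket_add_right) (simp add: algebra_simps)
      with add show ?case by simp
    next
      case (single e f)
      note sw = skew_form_swap[OF assms, of b a] skew_form_swap[OF assms, of e a]
        skew_form_swap[OF assms, of e b]
      show ?case
        by (simp add: skew_bracket_single skew_form_add_right add_ac single_add[symmetric])
          (simp add: sw algebra_simps)
    qed
  qed
qed

lemma partial_in_polys:
  assumes "p \<in> polys n" shows "partial i p \<in> polys n"
  unfolding partial_def
proof (rule polys_sum)
  fix a assume "a \<in> Poly_Mapping.keys p"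
  then have a: "Poly_Mapping.keys a \<subseteq> {1..n}" using assms by (auto simp: polys_def)
  have "Poly_Mapping.keys (a - Poly_Mapping.single i 1) \<subseteq> Poly_Mapping.keys a"
    by (auto simp: in_keys_iff lookup_minus)
  with a show "Poly_Mapping.single (a - Poly_Mapping.single i 1)
     (of_nat (Poly_Mapping.lookup a i) * Poly_Mapping.lookup p a) \<in> polys n"
    by (auto simp: polys_def split: if_splits)
qed

lemma skew_bracket_in_polys:
  "p \<in> polys n \<Longrightarrow> q \<in> polys n \<Longrightarrow> skew_bracket n \<Lambda> p q \<in> polys n"
  unfolding skew_bracket_def
  by (intro polys_sum polys_mult polys_closed partial_in_polys)

lemma Const_simps:
  "Const (a + b) = Const a + Const b" "Const (a * b) = Const a * Const b" "Const 1 = 1" "Const 0 = 0"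
  by (simp_all add: Const_def single_add mult_single)

lemma partial_Const_mult: "partial i (Const c * p) = Const c * partial i p"
proof (induction p rule: mpoly_induct)
  case (single a d)
  show ?case by (simp add: Const_def mult_single partial_single mult_ac)
qed (simp add: distrib_left partial_add)

lemma skew_quadratic_cring: "cring (skew_quadratic n \<Lambda>)"
proof (rule cringI)
  show "abelian_group (skew_quadratic n \<Lambda>)"
    by (rule abelian_groupI)
      (auto simp: polys_closed add_ac intro!: bexI[of _ "- x" for x] intro: polys_closed)
  show "comm_monoid (skew_quadratic n \<Lambda>)"
    by (rule comm_monoidI) (auto simp: polys_closed polys_mult mult_ac)
qed (simp add: distrib_right)

lemma skew_bracket_Const_mult:
  "skew_bracket n \<Lambda> (Const c * p) q = Const c * skew_bracket n \<Lambda> p q"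
  "skew_bracket n \<Lambda> p (Const c * q) = Const c * skew_bracket n \<Lambda> p q"
  unfolding skew_bracket_def partial_Const_mult sum_distrib_left
  by (simp_all only: ac_simps)

lemma skew_bracket_Const: "skew_bracket n \<Lambda> p (Const c) = 0"
proof -
  have "skew_bracket n \<Lambda> p 1 = skew_bracket n \<Lambda> p 1 + skew_bracket n \<Lambda> p 1"
    using skew_bracket_leibniz[of n \<Lambda> p 1 1] unfolding mult_1_left mult_1_right .
  then have "skew_bracket n \<Lambda> p 1 = 0" by (rule add_cancel_right_right[THEN iffD1])
  then show ?thesis using skew_bracket_Const_mult(2)[of n \<Lambda> p c 1] by simp
qed

theorem skew_quadratic_poisson_algebra:
  assumes "skew_matrix n \<Lambda>"
  shows "poisson_algebra scalars (skew_quadratic n \<Lambda>)"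
proof (intro poisson_algebra.intro algebraI poisson_algebra_axioms.intro skew_quadratic_cring
    cring_from_type_algebra)
qed (simp_all add: polys_closed Const_simps distrib_left distrib_right mult.assoc
    skew_bracket_in_polys skew_bracket_add_left skew_bracket_add_right skew_bracket_self[OF assms]
    skew_bracket_jacobi[OF assms] skew_bracket_leibniz skew_bracket_Const_mult skew_bracket_Const)

lemma skew_bracket_Var:
  assumes "i \<in> {1..n}" "j \<in> {1..n}"
  shows "skew_bracket n \<Lambda> (Var i) (Var j) = Const (\<Lambda> i j) * Var i * Var j"
proof -
  have [simp]: "of_nat (Poly_Mapping.lookup (Poly_Mapping.single i 1) k) = (if k = i then 1 else 0 :: 'a)"
    for i k by (simp add: lookup_single when_def)
  have 1: "\<Lambda> k l * of_nat (Poly_Mapping.lookup (Poly_Mapping.single i 1) k) *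
      of_nat (Poly_Mapping.lookup (Poly_Mapping.single j 1) l) =
      (if k = i then if l = j then \<Lambda> k l else 0 else 0)" for k l
    by (simp del: One_nat_def)
  have "skew_form n \<Lambda> (Poly_Mapping.single i 1) (Poly_Mapping.single j 1) =
      (\<Sum>k\<in>{1..n}. if k = i then \<Sum>l\<in>{1..n}. if l = j then \<Lambda> k l else 0 else 0)"
    unfolding skew_form_def 1 by (intro sum.cong refl) simp
  also have "\<dots> = \<Lambda> i j" using assms by simp
  finally show ?thesis
    by (simp only: Var_def skew_bracket_single) (simp add: Const_def mult_single)
qed

lemma polys_induct [consumes 1, case_names add Const Var]:
  assumes "p \<in> polys n"
    and add: "\<And>p q. p \<in> polys n \<Longrightarrow> q \<in> polys n \<Longrightarrow> P p \<Longrightarrow> P q \<Longrightarrow> P (p + q)"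
    and Const: "\<And>c. P (Const c)"
    and Var: "\<And>i q. i \<in> {1..n} \<Longrightarrow> q \<in> polys n \<Longrightarrow> P q \<Longrightarrow> P (Var i * q)"
  shows "P p"
proof -
  have mon: "P (Poly_Mapping.single a c)"
    if "Poly_Mapping.keys a \<subseteq> {1..n}" "(\<Sum>i\<in>{1..n}. Poly_Mapping.lookup a i) = k" for a c k
    using that
  proof (induction k arbitrary: a)
    case 0
    have "Poly_Mapping.lookup a i = 0" for i
    proof (cases "i \<in> {1..n}")
      case True
      then show ?thesis using 0(2) by simp
    next
      case False
      then show ?thesis using 0(1) by (auto simp: in_keys_iff)
    qed
    then have "a = 0" by (intro poly_mapping_eqI) simp
    then show ?case using Const[of c] by (simp add: Const_def)
  next
    case (Suc k)
    then obtain i where i: "i \<in> {1..n}" "Poly_Mapping.lookup a i \<noteq> 0"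
      by (metis Zero_not_Suc sum.neutral)
    define b where "b = a - Poly_Mapping.single i 1"
    have a: "a = Poly_Mapping.single i 1 + b"
      using i(2) unfolding b_def
      by (intro poly_mapping_eqI) (auto simp: lookup_add lookup_minus lookup_single when_def)
    have b: "Poly_Mapping.keys b \<subseteq> {1..n}"
    proof
      fix j assume "j \<in> Poly_Mapping.keys b"
      then have "j \<in> Poly_Mapping.keys a" by (auto simp: b_def in_keys_iff lookup_minus)
      then show "j \<in> {1..n}" using Suc.prems(1) by blast
    qed
    have "(\<Sum>j\<in>{1..n}. Poly_Mapping.lookup a j) =
        (\<Sum>j\<in>{1..n}. if j = i then 1 else 0) + (\<Sum>j\<in>{1..n}. Poly_Mapping.lookup b j)"
      unfolding sum.distrib[symmetric] a
      by (intro sum.cong refl) (simp add: lookup_add lookup_single when_def)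
    also have "(\<Sum>j\<in>{1..n}. if j = i then 1 else 0) = (1::nat)" using i(1) by simp
    finally have "P (Poly_Mapping.single b c)"
      using Suc.prems(2) by (intro Suc.IH b) simp
    then have "P (Var i * Poly_Mapping.single b c)"
      by (intro Var i(1) polys_single b)
    then show ?case by (simp add: Var_def mult_single a)
  qed
  have "P (\<Sum>a\<in>S. Poly_Mapping.single a (Poly_Mapping.lookup p a)) \<and>
      (\<Sum>a\<in>S. Poly_Mapping.single a (Poly_Mapping.lookup p a)) \<in> polys n"
    if "finite S" "S \<subseteq> Poly_Mapping.keys p" for S
    using that
  proof induction
    case empty
    show ?case using Const[of 0] by (simp add: Const_def polys_closed)
  next
    case (insert a S)
    then have "Poly_Mapping.keys a \<subseteq> {1..n}" using assms(1) by (auto simp: polys_def)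
    then show ?case using insert by (simp add: add mon polys_single polys_closed)
  qed
  moreover have "(\<Sum>a\<in>Poly_Mapping.keys p. Poly_Mapping.single a (Poly_Mapping.lookup p a)) = p"
    by (rule poly_mapping_eqI) (simp add: lookup_sum lookup_single when_def in_keys_iff)
  ultimately show ?thesis by (metis finite_keys order_refl)
qed

theorem skew_bracket_unique:
  fixes \<Lambda> :: "nat \<Rightarrow> nat \<Rightarrow> 'k::field"
  assumes skew: "skew_matrix n \<Lambda>"
    and B: "poisson_algebra scalars (skew_quadratic n \<Lambda>\<lparr>pbracket := B\<rparr>)"
    and gen: "\<And>i j. i \<in> {1..n} \<Longrightarrow> j \<in> {1..n} \<Longrightarrow> B (Var i) (Var j) = Const (\<Lambda> i j) * Var i * Var j"
    and "p \<in> polys n" "q \<in> polys n"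
  shows "B p q = skew_bracket n \<Lambda> p q"
proof -
  let ?C = "skew_bracket n \<Lambda>"
  have swapC: "?C p q = - ?C q p" for p q
  proof -
    have "?C (p + q) (p + q) = ?C p p + ?C q q + (?C p q + ?C q p)"
      by (simp only: skew_bracket_add_left skew_bracket_add_right add_ac)
    then show ?thesis by (simp add: skew_bracket_self[OF skew] eq_neg_iff_add_eq_0)
  qed
  have [simp]: "carrier (skew_quadratic n \<Lambda>\<lparr>pbracket := B\<rparr>) = polys n"
    "monoid.mult (skew_quadratic n \<Lambda>\<lparr>pbracket := B\<rparr>) = (*)"
    "ring.add (skew_quadratic n \<Lambda>\<lparr>pbracket := B\<rparr>) = (+)"
    "\<zero>\<^bsub>skew_quadratic n \<Lambda>\<lparr>pbracket := B\<rparr>\<^esub> = 0"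
    "module.smult (skew_quadratic n \<Lambda>\<lparr>pbracket := B\<rparr>) = (\<lambda>c p. Const c * p)"
    "pbracket (skew_quadratic n \<Lambda>\<lparr>pbracket := B\<rparr>) = B"
    by (simp_all add: skew_quadratic_def)
  have addl: "B (p + q) r = B p r + B q r" and addr: "B r (p + q) = B r p + B r q"
    and self: "B p p = 0" and leib: "B p (q * r) = B p q * r + q * B p r"
    if "p \<in> polys n" "q \<in> polys n" "r \<in> polys n" for p q r
    using that poisson_algebra.bracket_add_left[OF B, of p q r]
      poisson_algebra.bracket_add_right[OF B, of r p q]
      poisson_algebra.bracket_self[OF B, of p] poisson_algebra.bracket_leibniz[OF B, of p q r]
    by simp_all
  have swapB: "B p q = - B q p" if "p \<in> polys n" "q \<in> polys n" for p q
  proof -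
    have "B (p + q) (p + q) = B p p + B q q + (B p q + B q p)"
      using that by (simp only: addl addr polys_add add_ac)
    then show ?thesis using that by (simp add: self[of _ 0 0] polys_closed eq_neg_iff_add_eq_0)
  qed
  have BConst: "B p (Const c) = 0" if "p \<in> polys n" for p c
  proof -
    have "B p 1 = B p 1 + B p 1"
      using leib[OF that polys_basic(2) polys_basic(2)] unfolding mult_1_left mult_1_right .
    then have "B p 1 = 0" by (rule add_cancel_right_right[THEN iffD1])
    then show ?thesis
      using that poisson_algebra.bracket_smult_right[OF B, of c p 1] by (simp add: polys_closed)
  qed
  have ext: "B p q = ?C p q"
    if "p \<in> polys n" "q \<in> polys n" "\<And>i. i \<in> {1..n} \<Longrightarrow> B p (Var i) = ?C p (Var i)" for p q
    using that(2)
  proof (induction rule: polys_induct)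
    case (add q r)
    then show ?case by (simp only: addr[OF add(1,2) that(1)] skew_bracket_add_right)
  next
    case (Const c)
    show ?case by (simp only: BConst[OF that(1)] skew_bracket_Const)
  next
    case (Var i q)
    show ?case
      by (simp only: leib[OF that(1) polys_Var[OF Var(1)] Var(2)] skew_bracket_leibniz
          that(3)[OF Var(1)] Var(3))
  qed
  have "B (Var i) q = ?C (Var i) q" if "i \<in> {1..n}" "q \<in> polys n" for i q
    by (rule ext[OF polys_Var[OF that(1)] that(2)]) (simp only: gen[OF that(1)] skew_bracket_Var[OF that(1)])
  then have "B q (Var i) = ?C q (Var i)" if "i \<in> {1..n}" "q \<in> polys n" for i q
    using that swapB[OF that(2) polys_Var[OF that(1)]] swapC[of q "Var i"] by metis
  then show ?thesis using ext[OF assms(4,5)] assms(4) by blast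
qed

lemma polys_ge_iff: "p \<in> polys_ge n r \<longleftrightarrow> p \<in> polys n \<and> (\<forall>a\<in>Poly_Mapping.keys p. r \<le> mon_deg a)"
proof
  assume "p \<in> polys_ge n r"
  then obtain F where F: "finite F" "F \<subseteq> {f \<in> polys n. \<exists>d\<ge>r. homogeneous d f}" and p: "p = (\<Sum>f\<in>F. f)"
    by (auto simp: polys_ge_def)
  have "r \<le> mon_deg a" if "a \<in> Poly_Mapping.keys p" for a
  proof -
    have "Poly_Mapping.lookup p a \<noteq> 0" using that by (simp add: in_keys_iff)
    then obtain f where "f \<in> F" "Poly_Mapping.lookup f a \<noteq> 0"
      unfolding p lookup_sum by (meson sum.neutral)
    then show ?thesis using F(2) by (auto simp: homogeneous_def in_keys_iff)
  qed
  moreover have "p \<in> polys n" unfolding p using F(2) by (intro polys_sum) auto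
  ultimately show "p \<in> polys n \<and> (\<forall>a\<in>Poly_Mapping.keys p. r \<le> mon_deg a)" by blast
next
  assume p: "p \<in> polys n \<and> (\<forall>a\<in>Poly_Mapping.keys p. r \<le> mon_deg a)"
  define g where "g a = Poly_Mapping.single a (Poly_Mapping.lookup p a)" for a
  have inj: "inj_on g (Poly_Mapping.keys p)"
  proof (rule inj_onI)
    fix a b assume "a \<in> Poly_Mapping.keys p" "b \<in> Poly_Mapping.keys p" "g a = g b"
    then have "Poly_Mapping.lookup (g b) a \<noteq> 0"
      by (metis g_def in_keys_iff lookup_single_eq)
    then show "a = b" by (auto simp: g_def lookup_single when_def split: if_splits)
  qed
  have "p = (\<Sum>a\<in>Poly_Mapping.keys p. g a)"
    unfolding g_def by (rule poly_mapping_eqI) (simp add: lookup_sum lookup_single when_def in_keys_iff)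
  also have "\<dots> = (\<Sum>f\<in>g ` Poly_Mapping.keys p. f)"
    by (simp add: sum.reindex[OF inj])
  finally have "p = (\<Sum>f\<in>g ` Poly_Mapping.keys p. f)" .
  moreover have "g ` Poly_Mapping.keys p \<subseteq> {f \<in> polys n. \<exists>d\<ge>r. homogeneous d f}"
  proof
    fix f assume "f \<in> g ` Poly_Mapping.keys p"
    then obtain a where a: "a \<in> Poly_Mapping.keys p" "f = g a" by blast
    then have "f \<in> polys n" "homogeneous (mon_deg a) f" "r \<le> mon_deg a"
      using p by (auto simp: g_def polys_def homogeneous_def)
    then show "f \<in> {f \<in> polys n. \<exists>d\<ge>r. homogeneous d f}" by blast
  qed
  ultimately show "p \<in> polys_ge n r"
    unfolding polys_ge_def using finite_keys by blast
qed

end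

theory Submission
  imports Defs
begin

text \<open>Write \<open>P\<^sub>n\<close> for the polynomial algebra in \<open>n\<close> variables. An isomorphism
  \<open>P\<^sub>n/M \<rightarrow> P\<^sub>m/N\<close> is represented by polynomials: \<open>g i\<close> lifts the image of \<open>x\<^sub>i\<close>, and \<open>h k\<close> lifts a
  preimage of \<open>y\<^sub>k\<close> (\<open>poisson_iso_lift\<close>). It suffices to arrange that the \<open>g i\<close> have no constant
  terms and then to pass to linear parts, which form the tangent map at the origin.

  Constant terms. The bracket of \<open>P\<^sub>m\<close> has no terms of degree below two, and neither has an element
  of \<open>N\<close>. So the relation \<open>{g i, g j} \<equiv> \<lambda>\<^sub>i\<^sub>j g i g j\<close> modulo \<open>N\<close> shows that the constant and linear
  terms of \<open>g i g j\<close> vanish for \<open>i \<noteq> j\<close>. If \<open>g s\<close> has a nonzero constant term, then all other \<open>g j\<close>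
  have zero linear part, so the tangent space of \<open>P\<^sub>m/N\<close> at the origin is at most a line and the
  bracket on \<open>P\<^sub>m\<close> vanishes; for \<open>n \<ge> 2\<close> this would put \<open>x\<^sub>s x\<^sub>j\<close> into \<open>M\<close>, which starts in degree
  three (\<open>off_center_imp_n_eq_1\<close>). For \<open>n = 1\<close>, a graded ideal \<open>M\<close> whose zero set contains a point
  other than the origin is zero, and a translation of the line repairs the lift (\<open>recenter\<close>).

  Tangent map. Let now all constant terms be zero, and let \<open>L\<close> and \<open>L'\<close> be the substitutions of the
  linear parts of \<open>g\<close> and \<open>h\<close>. Taking lowest degree components shows that \<open>L\<close> and \<open>L'\<close> are mutually
  inverse and, as \<open>M\<close> and \<open>N\<close> are graded, that \<open>L\<close> maps \<open>M\<close> into \<open>N\<close> and \<open>L'\<close> maps \<open>N\<close> into \<open>M\<close>;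
  so \<open>L'\<close> carries \<open>N\<close> onto \<open>M\<close> (\<open>dh_image\<close>). The degree two component of
  \<open>{g i, g j} - \<lambda>\<^sub>i\<^sub>j g i g j\<close> lies in \<open>N\<close>, and \<open>L'\<close> maps it into the degree two part of \<open>M\<close>, which is
  zero; hence \<open>{L x\<^sub>i, L x\<^sub>j} = \<lambda>\<^sub>i\<^sub>j L x\<^sub>i L x\<^sub>j\<close> holds in \<open>P\<^sub>m\<close> itself (\<open>dg_bracket\<close>). Restricted to a
  coordinate axis every bracket is zero, so no \<open>y\<^sub>k\<close> occurs in both \<open>L x\<^sub>i\<close> and \<open>L x\<^sub>j\<close> for \<open>i \<noteq> j\<close>.
  An invertible matrix with at most one nonzero entry in each column is monomial
  (\<open>monomial_matrix\<close>), so \<open>L'\<close> permutes the variables up to scalars, and comparing coefficients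
  gives the equality of the \<open>\<lambda>\<close>'s.\<close>

section \<open>Homogeneous components\<close>

lemma lookup_Const_mult: "Poly_Mapping.lookup (Const c * p) a = c * Poly_Mapping.lookup p a"
proof (induction p rule: mpoly_induct)
  case (single b d)
  show ?case by (simp add: Const_def mult_single lookup_single when_def)
qed (simp add: distrib_left lookup_add)

lemma Const_eq_0_iff [simp]: "Const c = 0 \<longleftrightarrow> c = 0"
  by (metis Const_def keys_eq_empty keys_single insert_not_empty single_zero)

lemma Const_uminus: "Const (- c) = - Const c"
  by (simp add: Const_def single_uminus)

lemma Var_neq_0 [simp]: "Var i \<noteq> (0 :: 'k::field mpoly)"
proof
  assume "Var i = (0 :: 'k mpoly)"
  then have "Poly_Mapping.lookup (Var i :: 'k mpoly) (Poly_Mapping.single i 1) = 0" by simp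
  then show False unfolding Var_def lookup_single_eq by simp
qed

lemma lookup_Var:
  "Poly_Mapping.lookup (Var i :: 'k::field mpoly) (Poly_Mapping.single k 1) = (if i = k then 1 else 0)"
proof -
  have "Poly_Mapping.single i (1::nat) = Poly_Mapping.single k 1 \<longleftrightarrow> i = k"
    by (metis lookup_single_eq lookup_single_not_eq zero_neq_one)
  then show ?thesis unfolding Var_def lookup_single when_def by presburger
qed

lemma mon_deg_superset:
  assumes "finite S" "Poly_Mapping.keys a \<subseteq> S"
  shows "mon_deg a = (\<Sum>i\<in>S. Poly_Mapping.lookup a i)"
  unfolding mon_deg_def using assms by (intro sum.mono_neutral_left) (auto simp: in_keys_iff)

lemma mon_deg_add: "mon_deg (a + b) = mon_deg a + mon_deg b"
  using keys_add[of a b]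
  by (simp add: mon_deg_superset[of "Poly_Mapping.keys a \<union> Poly_Mapping.keys b"]
      lookup_add sum.distrib)

lemma mon_deg_single [simp]: "mon_deg (Poly_Mapping.single i d) = d"
  by (subst mon_deg_superset[of "{i}"]) auto

lemma mon_deg_0 [simp]: "mon_deg 0 = 0"
  by (simp add: mon_deg_def)

lemma mon_deg_eq_0_iff: "mon_deg a = 0 \<longleftrightarrow> a = 0"
  by (auto simp: mon_deg_def in_keys_iff intro: poly_mapping_eqI)

lemma mon_deg_SucE:
  assumes "mon_deg a = Suc d"
  obtains i b where "i \<in> Poly_Mapping.keys a" "a = Poly_Mapping.single i 1 + b" "mon_deg b = d"
proof -
  from assms obtain i where i: "i \<in> Poly_Mapping.keys a"
    by (metis keys_eq_empty equals0I mon_deg_0 Zero_not_Suc)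
  define b where "b = a - Poly_Mapping.single i 1"
  have a: "a = Poly_Mapping.single i 1 + b"
    using i unfolding b_def
    by (intro poly_mapping_eqI) (auto simp: lookup_add lookup_minus lookup_single when_def in_keys_iff)
  then have "mon_deg a = 1 + mon_deg b" by (simp only: mon_deg_add mon_deg_single)
  with that[OF i a] assms show ?thesis by simp
qed

definition hom_part :: "nat \<Rightarrow> 'k::field mpoly \<Rightarrow> 'k mpoly" where
  "hom_part d p = (\<Sum>a\<in>{a \<in> Poly_Mapping.keys p. mon_deg a = d}.
     Poly_Mapping.single a (Poly_Mapping.lookup p a))"

lemma lookup_hom_part:
  "Poly_Mapping.lookup (hom_part d p) a = (if mon_deg a = d then Poly_Mapping.lookup p a else 0)"
  by (auto simp: hom_part_def lookup_sum lookup_single when_def in_keys_iff)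

lemma hom_part_add: "hom_part d (p + q) = hom_part d p + hom_part d q"
  by (rule poly_mapping_eqI) (simp add: lookup_hom_part lookup_add)

lemma hom_part_diff: "hom_part d (p - q) = hom_part d p - hom_part d q"
  by (rule poly_mapping_eqI) (simp add: lookup_hom_part lookup_minus)

lemma hom_part_zero [simp]: "hom_part d 0 = 0"
  by (rule poly_mapping_eqI) (simp add: lookup_hom_part)

lemma hom_part_sum: "hom_part d (\<Sum>i\<in>I. f i) = (\<Sum>i\<in>I. hom_part d (f i))"
  by (induction I rule: infinite_finite_induct) (auto simp: hom_part_add)

lemma hom_part_single:
  "hom_part d (Poly_Mapping.single a c) = (if mon_deg a = d then Poly_Mapping.single a c else 0)"
  by (rule poly_mapping_eqI) (auto simp: lookup_hom_part lookup_single when_def)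

lemma hom_part_Const_mult: "hom_part d (Const c * p) = Const c * hom_part d p"
  by (rule poly_mapping_eqI) (simp add: lookup_hom_part lookup_Const_mult)

lemma hom_part_Const: "hom_part d (Const c) = (if d = 0 then Const c else 0)"
  by (auto simp: Const_def hom_part_single)

lemma hom_part_Var: "hom_part d (Var i) = (if d = 1 then Var i else 0)"
  unfolding Var_def by (simp only: hom_part_single mon_deg_single) auto

lemma hom_part_hom_part: "hom_part d (hom_part e p) = (if d = e then hom_part d p else 0)"
  by (rule poly_mapping_eqI) (simp add: lookup_hom_part)

lemma homogeneous_iff_hom_part: "homogeneous d p \<longleftrightarrow> hom_part d p = p"
proof
  assume "homogeneous d p"
  then show "hom_part d p = p"
    by (intro poly_mapping_eqI) (auto simp: homogeneous_def lookup_hom_part in_keys_iff)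
next
  assume p: "hom_part d p = p"
  show "homogeneous d p"
    unfolding homogeneous_def
  proof
    fix a assume "a \<in> Poly_Mapping.keys p"
    then have "Poly_Mapping.lookup (hom_part d p) a \<noteq> 0" by (simp add: p in_keys_iff)
    then show "mon_deg a = d" by (simp add: lookup_hom_part split: if_splits)
  qed
qed

lemma hom_part_in_polys: "p \<in> polys n \<Longrightarrow> hom_part d p \<in> polys n"
  unfolding hom_part_def by (intro polys_sum polys_single) (auto simp: polys_def)

lemma hom_part_0: "hom_part 0 p = Const (Poly_Mapping.lookup p 0)"
proof (rule poly_mapping_eqI)
  fix a
  show "Poly_Mapping.lookup (hom_part 0 p) a = Poly_Mapping.lookup (Const (Poly_Mapping.lookup p 0)) a"
    by (auto simp: lookup_hom_part mon_deg_eq_0_iff Const_def lookup_single when_def)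
qed

text \<open>The product and the Poisson bracket are both graded for the same reason: they are biadditive and
  send two monomials to a multiple of the product monomial.\<close>

lemma hom_part_biadditive:
  fixes F :: "'k::field mpoly \<Rightarrow> 'k mpoly \<Rightarrow> 'k mpoly"
  assumes addl: "\<And>p q r. F (p + q) r = F p r + F q r"
    and addr: "\<And>p q r. F p (q + r) = F p q + F p r"
    and single: "\<And>a b c e. \<exists>x. F (Poly_Mapping.single a c) (Poly_Mapping.single b e) = Poly_Mapping.single (a + b) x"
  shows "hom_part d (F p q) = (\<Sum>i\<le>d. F (hom_part i p) (hom_part (d - i) q))"
proof (induction p rule: mpoly_induct)
  case (single a c)
  have 0: "F 0 r = 0" "F r 0 = 0" for r
    using addl[of 0 0 r] addr[of r 0 0]
    unfolding add_0 by (blast intro: add_cancel_right_right[THEN iffD1])+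
  show ?case
  proof (induction q rule: mpoly_induct)
    case (single b e)
    let ?a = "Poly_Mapping.single a c" and ?b = "Poly_Mapping.single b e"
    obtain x where x: "F ?a ?b = Poly_Mapping.single (a + b) x" using assms(3) by blast
    have "(\<Sum>i\<le>d. F (hom_part i ?a) (hom_part (d - i) ?b)) =
        (\<Sum>i\<le>d. if i = mon_deg a then if mon_deg b = d - i then F ?a ?b else 0 else 0)"
      by (intro sum.cong refl) (auto simp: hom_part_single 0)
    also have "\<dots> = (if mon_deg (a + b) = d then F ?a ?b else 0)"
      by (auto simp: mon_deg_add)
    finally show ?case by (simp add: x hom_part_single)
  qed (simp add: hom_part_add addr sum.distrib)
qed (simp add: hom_part_add addl sum.distrib)

lemma hom_part_mult: "hom_part d (p * q) = (\<Sum>i\<le>d. hom_part i p * hom_part (d - i) q)"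
  by (rule hom_part_biadditive) (auto simp: algebra_simps mult_single)

lemma sum_hom_part:
  fixes p :: "'k::field mpoly"
  shows "p = (\<Sum>d\<in>mon_deg ` Poly_Mapping.keys p. hom_part d p)"
  by (rule poly_mapping_eqI) (auto simp: lookup_sum lookup_hom_part in_keys_iff)

lemma hom_part_1_eq:
  fixes p :: "'k::field mpoly"
  assumes "p \<in> polys m"
  shows "hom_part 1 p = (\<Sum>k\<in>{1..m}. Const (Poly_Mapping.lookup p (Poly_Mapping.single k 1)) * Var k)"
proof (rule poly_mapping_eqI)
  fix a
  let ?c = "\<lambda>k. Poly_Mapping.lookup p (Poly_Mapping.single k 1)"
  have R: "Poly_Mapping.lookup (\<Sum>k\<in>{1..m}. Const (?c k) * Var k) a =
      (\<Sum>k\<in>{1..m}. ?c k * Poly_Mapping.lookup (Var k) a)"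
    by (simp add: lookup_sum lookup_Const_mult)
  show "Poly_Mapping.lookup (hom_part 1 p) a = Poly_Mapping.lookup (\<Sum>k\<in>{1..m}. Const (?c k) * Var k) a"
  proof (cases "mon_deg a = 1")
    case True
    then obtain i where a: "a = Poly_Mapping.single i 1"
      by (metis One_nat_def mon_deg_SucE mon_deg_eq_0_iff add_0_right)
    have "(\<Sum>k\<in>{1..m}. ?c k * Poly_Mapping.lookup (Var k) a) = (\<Sum>k\<in>{1..m}. if k = i then ?c k else 0)"
      unfolding a by (intro sum.cong refl) (simp add: lookup_Var del: One_nat_def)
    also have "\<dots> = Poly_Mapping.lookup p a"
    proof (cases "i \<in> {1..m}")
      case False
      then have "a \<notin> Poly_Mapping.keys p" using assms by (auto simp: polys_def a)
      then show ?thesis using False by (auto simp: in_keys_iff)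
    qed (simp add: a)
    finally show ?thesis by (simp add: R lookup_hom_part True del: One_nat_def)
  next
    case False
    then have "Poly_Mapping.lookup (Var k :: 'k mpoly) a = 0" for k
      by (metis Var_def lookup_single_not_eq mon_deg_single)
    then show ?thesis using False by (simp add: R lookup_hom_part del: One_nat_def)
  qed
qed

lemma hom_part_0_mult: "hom_part 0 (p * q) = hom_part 0 p * hom_part 0 q"
  by (simp add: hom_part_mult)

lemma hom_part_1_mult: "hom_part 1 (p * q) = hom_part 0 p * hom_part 1 q + hom_part 1 p * hom_part 0 q"
  by (simp add: hom_part_mult)

text \<open>The order of vanishing at the origin is at least \<open>r\<close>.\<close>

definition order_ge :: "nat \<Rightarrow> 'k::field mpoly \<Rightarrow> bool" where
  "order_ge r p \<longleftrightarrow> (\<forall>d<r. hom_part d p = 0)"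

lemma order_ge_mult:
  assumes "order_ge r p" "order_ge s q"
  shows "order_ge (r + s) (p * q)" and "hom_part (r + s) (p * q) = hom_part r p * hom_part s q"
proof -
  have 0: "hom_part i p * hom_part j q = 0" if "i < r \<or> j < s" for i j
    using that assms by (auto simp: order_ge_def)
  show "order_ge (r + s) (p * q)"
    unfolding order_ge_def hom_part_mult by (intro allI impI sum.neutral ballI 0) auto
  have "(\<Sum>i\<le>r+s. hom_part i p * hom_part (r + s - i) q) =
      (\<Sum>i\<in>{r}. hom_part i p * hom_part (r + s - i) q)"
    by (intro sum.mono_neutral_right ballI 0) auto
  then show "hom_part (r + s) (p * q) = hom_part r p * hom_part s q"
    by (simp add: hom_part_mult)
qed

lemma polys_ge_order_ge: "p \<in> polys_ge n r \<Longrightarrow> order_ge r p"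
proof -
  assume p: "p \<in> polys_ge n r"
  have "Poly_Mapping.lookup (hom_part d p) a = 0" if "d < r" for d a
  proof (cases "a \<in> Poly_Mapping.keys p")
    case True
    then have "d < mon_deg a" using p that unfolding polys_ge_iff by force
    then show ?thesis by (simp add: lookup_hom_part)
  qed (simp add: lookup_hom_part in_keys_iff)
  then show ?thesis by (auto simp: order_ge_def intro!: poly_mapping_eqI)
qed

section \<open>Substitution\<close>

definition mon_eval :: "(nat \<Rightarrow> 'k::field mpoly) \<Rightarrow> (nat \<Rightarrow>\<^sub>0 nat) \<Rightarrow> 'k mpoly" where
  "mon_eval g a = (\<Prod>i\<in>Poly_Mapping.keys a. g i ^ Poly_Mapping.lookup a i)"

text \<open>The homomorphism of \<open>K\<close>-algebras that sends each variable \<open>x\<^sub>i\<close> to \<open>g i\<close>.\<close>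

definition substitute :: "(nat \<Rightarrow> 'k::field mpoly) \<Rightarrow> 'k mpoly \<Rightarrow> 'k mpoly" where
  "substitute g p = (\<Sum>a\<in>Poly_Mapping.keys p. Const (Poly_Mapping.lookup p a) * mon_eval g a)"

lemma mon_eval_superset:
  assumes "finite S" "Poly_Mapping.keys a \<subseteq> S"
  shows "mon_eval g a = (\<Prod>i\<in>S. g i ^ Poly_Mapping.lookup a i)"
  unfolding mon_eval_def using assms by (intro prod.mono_neutral_left) (auto simp: in_keys_iff)

lemma mon_eval_add: "mon_eval g (a + b) = mon_eval g a * mon_eval g b"
  using keys_add[of a b]
  by (simp add: mon_eval_superset[of "Poly_Mapping.keys a \<union> Poly_Mapping.keys b"]
      lookup_add power_add prod.distrib)

lemma mon_eval_single: "mon_eval g (Poly_Mapping.single i d) = g i ^ d"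
  by (subst mon_eval_superset[of "{i}"]) auto

lemma substitute_superset:
  assumes "finite S" "Poly_Mapping.keys p \<subseteq> S"
  shows "substitute g p = (\<Sum>a\<in>S. Const (Poly_Mapping.lookup p a) * mon_eval g a)"
  unfolding substitute_def using assms by (intro sum.mono_neutral_left) (auto simp: in_keys_iff Const_simps)

lemma substitute_add: "substitute g (p + q) = substitute g p + substitute g q"
  using keys_add[of p q]
  by (simp add: substitute_superset[of "Poly_Mapping.keys p \<union> Poly_Mapping.keys q"]
      lookup_add Const_simps distrib_right sum.distrib)

lemma substitute_zero [simp]: "substitute g 0 = 0"
  by (simp add: substitute_def)

lemma substitute_uminus: "substitute g (- p) = - substitute g p"
  by (simp add: substitute_def Const_uminus sum_negf)

lemma substitute_diff: "substitute g (p - q) = substitute g p - substitute g q"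
  using substitute_add[of g p "- q"] by (simp add: substitute_uminus)

lemma substitute_single: "substitute g (Poly_Mapping.single a c) = Const c * mon_eval g a"
  by (subst substitute_superset[of "{a}"]) auto

lemma substitute_mult: "substitute g (p * q) = substitute g p * substitute g q"
proof (induction p rule: mpoly_induct)
  case (single a c)
  show ?case
  proof (induction q rule: mpoly_induct)
    case (single b d)
    show ?case by (simp add: mult_single substitute_single mon_eval_add Const_simps mult_ac)
  qed (simp add: distrib_left substitute_add)
qed (simp add: distrib_right substitute_add)

lemma substitute_Const [simp]: "substitute g (Const c) = Const c"
  using substitute_single[of g 0 c] by (simp add: Const_def mon_eval_def)

lemma substitute_one [simp]: "substitute g 1 = 1"
  using substitute_Const[of g 1] by (simp only: Const_simps)

lemma substitute_Var [simp]: "substitute g (Var i) = g i"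
  unfolding Var_def by (simp only: substitute_single mon_eval_single Const_simps) simp

lemma substitute_sum: "substitute g (\<Sum>i\<in>I. f i) = (\<Sum>i\<in>I. substitute g (f i))"
  by (induction I rule: infinite_finite_induct) (auto simp: substitute_add)

lemmas substitute_simps = substitute_add substitute_diff substitute_mult

lemma substitute_cong:
  assumes "p \<in> polys n" "\<And>i. i \<in> {1..n} \<Longrightarrow> g i = g' i"
  shows "substitute g p = substitute g' p"
  using assms(1) by (induction rule: polys_induct) (auto simp: substitute_simps assms(2))

lemma substitute_Var_id:
  assumes "p \<in> polys n" "\<And>i. i \<in> {1..n} \<Longrightarrow> g i = Var i"
  shows "substitute g p = p"
  using assms(1) by (induction rule: polys_induct) (auto simp: substitute_simps assms(2))

lemma substitute_substitute:
  assumes "p \<in> polys n"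
  shows "substitute g (substitute f p) = substitute (\<lambda>i. substitute g (f i)) p"
  using assms by (induction rule: polys_induct) (auto simp: substitute_simps)

lemma substitute_in_polys:
  assumes "p \<in> polys n" "\<And>i. i \<in> {1..n} \<Longrightarrow> g i \<in> polys m"
  shows "substitute g p \<in> polys m"
  using assms(1)
  by (induction rule: polys_induct) (auto simp: substitute_simps polys_closed assms(2))

lemma mon_eval_lowest:
  assumes "\<And>i. i \<in> Poly_Mapping.keys a \<Longrightarrow> hom_part 0 (g i) = 0"
  shows "order_ge (mon_deg a) (mon_eval g a) \<and>
    hom_part (mon_deg a) (mon_eval g a) = mon_eval (\<lambda>i. hom_part 1 (g i)) a"
  using assms
proof (induction "mon_deg a" arbitrary: a)
  case 0
  then have "a = 0" by (simp add: mon_deg_eq_0_iff)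
  then show ?case
    using hom_part_Const[of 0 1] by (simp add: mon_eval_def order_ge_def Const_simps)
next
  case (Suc d)
  then obtain i b where i: "i \<in> Poly_Mapping.keys a" and a: "a = Poly_Mapping.single i 1 + b"
      and d: "mon_deg b = d"
    by (metis mon_deg_SucE)
  have "Poly_Mapping.keys b \<subseteq> Poly_Mapping.keys a"
    by (auto simp: a in_keys_iff lookup_add)
  then have IH: "order_ge d (mon_eval g b)"
      "hom_part d (mon_eval g b) = mon_eval (\<lambda>i. hom_part 1 (g i)) b"
    using Suc(1)[of b] Suc(3) d by auto
  have "order_ge 1 (g i)" using Suc(3)[OF i] by (simp add: order_ge_def)
  from order_ge_mult[OF this IH(1)] IH(2) Suc(2) show ?case
    by (simp only: a mon_eval_add mon_eval_single power_one_right plus_1_eq_Suc)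
qed

text \<open>The chain rule at the origin, in every degree: a substitution without constant terms acts on
  the lowest component of a polynomial by its linear part. For \<open>d = 1\<close> this is functoriality of the
  tangent map; for larger \<open>d\<close> it is what makes the linear part respect graded ideals.\<close>

lemma hom_part_substitute:
  assumes p: "p \<in> polys n" "order_ge d p"
    and g: "\<And>i. i \<in> {1..n} \<Longrightarrow> hom_part 0 (g i) = 0"
  shows "hom_part d (substitute g p) = substitute (\<lambda>i. hom_part 1 (g i)) (hom_part d p)"
proof -
  have deg: "d \<le> mon_deg a" if "a \<in> Poly_Mapping.keys p" for a
  proof (rule ccontr)
    assume "\<not> d \<le> mon_deg a"
    then have "hom_part (mon_deg a) p = 0" using p(2) by (simp add: order_ge_def)
    then show False using that lookup_hom_part[of "mon_deg a" p a] by (simp add: in_keys_iff)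
  qed
  have low: "order_ge (mon_deg a) (mon_eval g a)"
      "hom_part (mon_deg a) (mon_eval g a) = mon_eval (\<lambda>i. hom_part 1 (g i)) a"
    if "a \<in> Poly_Mapping.keys p" for a
  proof -
    have "Poly_Mapping.keys a \<subseteq> {1..n}" using that p(1) by (auto simp: polys_def)
    then show "order_ge (mon_deg a) (mon_eval g a)"
      "hom_part (mon_deg a) (mon_eval g a) = mon_eval (\<lambda>i. hom_part 1 (g i)) a"
      using mon_eval_lowest[of a g] g by blast+
  qed
  have "hom_part d (substitute g p) = (\<Sum>a\<in>Poly_Mapping.keys p.
      Const (Poly_Mapping.lookup p a) * hom_part d (mon_eval g a))"
    by (simp add: substitute_def hom_part_sum hom_part_Const_mult)
  also have "\<dots> = (\<Sum>a\<in>Poly_Mapping.keys p. Const (Poly_Mapping.lookup (hom_part d p) a) *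
      mon_eval (\<lambda>i. hom_part 1 (g i)) a)"
  proof (intro sum.cong refl)
    fix a assume a: "a \<in> Poly_Mapping.keys p"
    show "Const (Poly_Mapping.lookup p a) * hom_part d (mon_eval g a) =
      Const (Poly_Mapping.lookup (hom_part d p) a) * mon_eval (\<lambda>i. hom_part 1 (g i)) a"
    proof (cases "mon_deg a = d")
      case True
      then show ?thesis using low[OF a] by (simp add: lookup_hom_part)
    next
      case False
      then have "d < mon_deg a" using deg[OF a] by simp
      then have "hom_part d (mon_eval g a) = 0" using low(1)[OF a] by (simp add: order_ge_def)
      then show ?thesis using False by (simp add: lookup_hom_part Const_simps)
    qed
  qed
  also have "\<dots> = substitute (\<lambda>i. hom_part 1 (g i)) (hom_part d p)"
    by (rule substitute_superset[symmetric]) (auto simp: lookup_hom_part in_keys_iff split: if_splits)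
  finally show ?thesis .
qed

lemma hom_part_substitute_linear:
  assumes "p \<in> polys n" "hom_part d p = p" "\<And>i. i \<in> {1..n} \<Longrightarrow> hom_part 1 (g i) = g i"
  shows "hom_part d (substitute g p) = substitute g p"
proof -
  have low: "order_ge d p" unfolding order_ge_def
    using hom_part_hom_part[of _ d p] assms(2) by (metis less_irrefl)
  have "hom_part 0 (g i) = 0" if "i \<in> {1..n}" for i
    using hom_part_hom_part[of 0 1 "g i"] assms(3)[OF that] by simp
  then have "hom_part d (substitute g p) = substitute (\<lambda>i. hom_part 1 (g i)) p"
    using hom_part_substitute[OF assms(1) low] assms(2) by simp
  also have "\<dots> = substitute g p" by (rule substitute_cong[OF assms(1,3)])
  finally show ?thesis .
qed

section \<open>The bracket\<close>

lemma hom_part_bracket: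
  "hom_part d (skew_bracket n \<Lambda> p q) = (\<Sum>i\<le>d. skew_bracket n \<Lambda> (hom_part i p) (hom_part (d - i) q))"
  by (rule hom_part_biadditive) (auto simp: skew_bracket_add_left skew_bracket_add_right skew_bracket_single)

lemma skew_bracket_Const_left: "skew_bracket n \<Lambda> (Const c) p = 0"
  by (simp add: skew_bracket_def Const_def partial_single)

lemma skew_bracket_low:
  assumes "d < 2" shows "hom_part d (skew_bracket n \<Lambda> p q) = 0"
proof -
  have "i = 0 \<or> d - i = 0" if "i \<le> d" for i using that assms by auto
  then show ?thesis unfolding hom_part_bracket
    by (intro sum.neutral ballI) (metis atMost_iff hom_part_0 skew_bracket_Const_left skew_bracket_Const)
qed

text \<open>On the \<open>k\<close>-th coordinate axis only the summand with \<open>i = j = k\<close> of a bracket could survive, and its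
  coefficient is the diagonal entry.\<close>

lemma substitute_axis_bracket:
  assumes "skew_matrix n \<Lambda>"
  shows "substitute (\<lambda>l. if l = k then Var k else 0) (skew_bracket n \<Lambda> p q) = 0"
  unfolding skew_bracket_def substitute_sum
proof (intro sum.neutral ballI)
  fix i j assume ij: "i \<in> {1..n}" "j \<in> {1..n}"
  show "substitute (\<lambda>l. if l = k then Var k else 0)
    (Const (\<Lambda> i j) * Var i * Var j * partial i p * partial j q) = 0"
  proof (cases "i = k \<and> j = k")
    case True
    then have "\<Lambda> i j = 0" using assms ij unfolding skew_matrix_def by blast
    then have "Const (\<Lambda> i j) = 0" by simp
    then show ?thesis by (simp only: mult_zero_left substitute_zero)
  next
    case False
    then show ?thesis by (auto simp: substitute_mult)
  qed
qed

lemma skew_bracket_swap: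
  assumes "skew_matrix n \<Lambda>"
  shows "skew_bracket n \<Lambda> p q = - skew_bracket n \<Lambda> q p"
proof -
  have "skew_bracket n \<Lambda> (p + q) (p + q) =
      skew_bracket n \<Lambda> p p + skew_bracket n \<Lambda> q q + (skew_bracket n \<Lambda> p q + skew_bracket n \<Lambda> q p)"
    by (simp only: skew_bracket_add_left skew_bracket_add_right add_ac)
  then show ?thesis by (simp add: skew_bracket_self[OF assms] eq_neg_iff_add_eq_0)
qed

text \<open>Both sides are biderivations along the substitution, so it suffices to compare them on variables.\<close>

lemma substitute_bracket:
  assumes skew: "skew_matrix n \<Lambda>" "skew_matrix m \<Lambda>'"
    and gen: "\<And>i j. i \<in> {1..n} \<Longrightarrow> j \<in> {1..n} \<Longrightarrow>
      skew_bracket m \<Lambda>' (g i) (g j) = Const (\<Lambda> i j) * g i * g j"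
    and "p \<in> polys n" "q \<in> polys n"
  shows "substitute g (skew_bracket n \<Lambda> p q) = skew_bracket m \<Lambda>' (substitute g p) (substitute g q)"
proof -
  have ext: "substitute g (skew_bracket n \<Lambda> p q) = skew_bracket m \<Lambda>' (substitute g p) (substitute g q)"
    if "\<And>i. i \<in> {1..n} \<Longrightarrow>
        substitute g (skew_bracket n \<Lambda> p (Var i)) = skew_bracket m \<Lambda>' (substitute g p) (g i)"
      and "q \<in> polys n" for p q
    using that(2)
    by (induction rule: polys_induct)
      (simp_all add: skew_bracket_add_right skew_bracket_leibniz skew_bracket_Const substitute_simps that(1))
  have "substitute g (skew_bracket n \<Lambda> (Var i) q) = skew_bracket m \<Lambda>' (g i) (substitute g q)"
    if "i \<in> {1..n}" "q \<in> polys n" for i q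
    using ext[of "Var i" q] that by (simp add: skew_bracket_Var substitute_simps gen)
  then have "substitute g (skew_bracket n \<Lambda> p (Var i)) = skew_bracket m \<Lambda>' (substitute g p) (g i)"
    if "i \<in> {1..n}" for i
    using that assms(4) by (simp add: skew_bracket_swap[OF skew(1), of p] skew_bracket_swap[OF skew(2), of "substitute g p"] substitute_uminus)
  then show ?thesis using ext assms(5) by blast
qed

section \<open>Graded ideals\<close>

lemma ideal_in_polys: "ideal I (skew_quadratic n \<Lambda>) \<Longrightarrow> p \<in> I \<Longrightarrow> p \<in> polys n"
  using ideal.Icarr by fastforce

lemma ideal_add: "ideal I (skew_quadratic n \<Lambda>) \<Longrightarrow> p \<in> I \<Longrightarrow> q \<in> I \<Longrightarrow> p + q \<in> I"
  using additive_subgroup.a_closed[OF ideal.axioms(1), of I "skew_quadratic n \<Lambda>" p q] by simp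

lemma ideal_zero: "ideal I (skew_quadratic n \<Lambda>) \<Longrightarrow> 0 \<in> I"
  using additive_subgroup.zero_closed[OF ideal.axioms(1), of I "skew_quadratic n \<Lambda>"] by simp

lemma ideal_mult: "ideal I (skew_quadratic n \<Lambda>) \<Longrightarrow> p \<in> I \<Longrightarrow> q \<in> polys n \<Longrightarrow> q * p \<in> I"
  using ideal.I_l_closed[of I "skew_quadratic n \<Lambda>" p q] by simp

lemma ideal_uminus: "ideal I (skew_quadratic n \<Lambda>) \<Longrightarrow> p \<in> I \<Longrightarrow> - p \<in> I"
  using ideal_mult[of I n \<Lambda> p "- 1"] by (simp add: polys_closed)

lemma ideal_diff: "ideal I (skew_quadratic n \<Lambda>) \<Longrightarrow> p \<in> I \<Longrightarrow> q \<in> I \<Longrightarrow> p - q \<in> I"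
  using ideal_add[of I n \<Lambda> p "- q"] by (simp add: ideal_uminus)

lemma ideal_sum:
  assumes "ideal I (skew_quadratic n \<Lambda>)" "\<And>i. i \<in> S \<Longrightarrow> f i \<in> I"
  shows "(\<Sum>i\<in>S. f i) \<in> I"
  using assms(2)
  by (induction S rule: infinite_finite_induct) (auto simp: ideal_zero[OF assms(1)] ideal_add[OF assms(1)])

lemma ideal_cong_iff:
  assumes "ideal I (skew_quadratic n \<Lambda>)" "p - q \<in> I"
  shows "p \<in> I \<longleftrightarrow> q \<in> I"
  using ideal_add[OF assms(1), of q "p - q"] ideal_diff[OF assms(1), of p "p - q"] assms(2) by auto

lemma skew_idealI:
  assumes "J \<subseteq> polys n" "0 \<in> J" "\<And>p q. p \<in> J \<Longrightarrow> q \<in> J \<Longrightarrow> p + q \<in> J"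
    and mult: "\<And>p q. p \<in> J \<Longrightarrow> q \<in> polys n \<Longrightarrow> q * p \<in> J"
  shows "ideal J (skew_quadratic n \<Lambda>)"
proof (rule idealI)
  interpret cring "skew_quadratic n \<Lambda>" by (rule skew_quadratic_cring)
  show "ring (skew_quadratic n \<Lambda>)" by (rule ring_axioms)
  show "subgroup J (add_monoid (skew_quadratic n \<Lambda>))"
  proof (rule add.subgroupI)
    show "J \<noteq> {}" using assms(2) by blast
    show "\<ominus>\<^bsub>skew_quadratic n \<Lambda>\<^esub> p \<in> J" if "p \<in> J" for p
    proof -
      have "\<ominus>\<^bsub>skew_quadratic n \<Lambda>\<^esub> p = - p"
        using that assms(1) by (intro minus_equality) (auto simp: polys_closed)
      then show ?thesis using mult[OF that, of "- 1"] by (simp add: polys_closed)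
    qed
  qed (use assms in auto)
qed (use mult in \<open>simp_all add: mult.commute\<close>)

text \<open>The polynomials all of whose components lie in \<open>I\<close> form an ideal that contains the homogeneous
  generators of \<open>I\<close>.\<close>

lemma graded_ideal_hom_part:
  assumes "graded_poisson_ideal I (skew_quadratic n \<Lambda>)" "p \<in> I"
  shows "hom_part d p \<in> I"
proof -
  let ?R = "skew_quadratic n \<Lambda>"
  from assms(1) obtain S where I: "ideal I ?R" and S: "S \<subseteq> {f \<in> polys n. \<exists>d. homogeneous d f}"
      and gen: "I = Idl\<^bsub>?R\<^esub> S"
    by (auto simp: graded_poisson_ideal_def poisson_ideal_def)
  interpret cring ?R by (rule skew_quadratic_cring)
  let ?J = "{q \<in> polys n. \<forall>d. hom_part d q \<in> I}"
  have "ideal ?J ?R"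
  proof (rule skew_idealI)
    show "q * p \<in> ?J" if "p \<in> ?J" "q \<in> polys n" for p q
      using that
      by (auto simp: hom_part_mult polys_mult hom_part_in_polys intro!: ideal_sum[OF I] ideal_mult[OF I])
  qed (auto simp: polys_closed hom_part_add ideal_zero[OF I] ideal_add[OF I])
  moreover have "S \<subseteq> ?J"
  proof
    fix f assume f: "f \<in> S"
    then obtain e where e: "f \<in> polys n" "hom_part e f = f" using S homogeneous_iff_hom_part by blast
    have "f \<in> I" using genideal_self[of S] S f unfolding gen by auto
    then have "hom_part d f \<in> I" for d
      using hom_part_hom_part[of d e f] e(2) ideal_zero[OF I] by (cases "d = e") auto
    then show "f \<in> ?J" using e by blast
  qed
  ultimately have "I \<subseteq> ?J" unfolding gen by (rule genideal_minimal)
  then show ?thesis using assms(2) by blast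
qed

lemma coset_eq_iff:
  assumes I: "ideal I (skew_quadratic n \<Lambda>)" and pq: "p \<in> polys n" "q \<in> polys n"
  shows "I +>\<^bsub>skew_quadratic n \<Lambda>\<^esub> p = I +>\<^bsub>skew_quadratic n \<Lambda>\<^esub> q \<longleftrightarrow> p - q \<in> I"
proof -
  let ?R = "skew_quadratic n \<Lambda>"
  interpret ideal I ?R by (rule I)
  have mem: "x \<in> I +>\<^bsub>?R\<^esub> y \<longleftrightarrow> x - y \<in> I" for x y
  proof -
    have "x \<in> I +>\<^bsub>?R\<^esub> y \<longleftrightarrow> (\<exists>h\<in>I. x = h + y)" by (auto simp: a_r_coset_def')
    also have "\<dots> \<longleftrightarrow> x - y \<in> I" by (metis add_diff_cancel diff_add_cancel)
    finally show ?thesis .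
  qed
  show ?thesis
    using a_rcos_self[of p] a_repr_independence'[of p q] pq by (auto simp: mem)
qed

text \<open>For \<open>p\<close> homogeneous of degree \<open>d\<close>, the image of \<open>p\<close> under the linear part is the component of
  degree \<open>d\<close> of its image under \<open>g\<close>; the general case follows by splitting \<open>p\<close> into components.\<close>

lemma linear_part_maps_ideal:
  assumes graded: "graded_poisson_ideal I (skew_quadratic n \<Lambda>)" "graded_poisson_ideal J (skew_quadratic m \<Lambda>')"
    and g: "\<And>i. i \<in> {1..n} \<Longrightarrow> hom_part 0 (g i) = 0"
    and maps: "\<And>p. p \<in> I \<Longrightarrow> substitute g p \<in> J"
    and p: "p \<in> I"
  shows "substitute (\<lambda>i. hom_part 1 (g i)) p \<in> J"
proof -
  have ideals: "ideal I (skew_quadratic n \<Lambda>)" "ideal J (skew_quadratic m \<Lambda>')"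
    using graded by (simp_all add: graded_poisson_ideal_def poisson_ideal_def)
  have "substitute (\<lambda>i. hom_part 1 (g i)) (hom_part d p) \<in> J" for d
  proof -
    have I: "hom_part d p \<in> I" by (rule graded_ideal_hom_part[OF graded(1) p])
    have "hom_part d (substitute g (hom_part d p)) \<in> J"
      by (rule graded_ideal_hom_part[OF graded(2) maps[OF I]])
    also have "hom_part d (substitute g (hom_part d p)) =
        substitute (\<lambda>i. hom_part 1 (g i)) (hom_part d (hom_part d p))"
      by (rule hom_part_substitute[OF ideal_in_polys[OF ideals(1) I] _ g])
        (auto simp: order_ge_def hom_part_hom_part)
    finally show ?thesis by (simp add: hom_part_hom_part)
  qed
  then have "(\<Sum>d\<in>mon_deg ` Poly_Mapping.keys p. substitute (\<lambda>i. hom_part 1 (g i)) (hom_part d p)) \<in> J"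
    by (intro ideal_sum[OF ideals(2)])
  then show ?thesis using sum_hom_part[of p] by (metis substitute_sum)
qed

section \<open>Monomial matrices\<close>

text \<open>Orthogonality allows at most one nonzero entry of \<open>u\<close> in each column, and invertibility at least
  one, in row \<open>s k\<close> say. If \<open>s k = s l\<close> with \<open>k \<noteq> l\<close>, then \<open>v\<close> could not be a left inverse; and every
  row is hit because \<open>v\<close> is also a right inverse.\<close>

lemma monomial_matrix:
  fixes u v :: "nat \<Rightarrow> nat \<Rightarrow> 'k::field"
  assumes fin: "finite A" "finite B"
    and uv: "\<And>i j. i \<in> A \<Longrightarrow> j \<in> A \<Longrightarrow> (\<Sum>k\<in>B. u i k * v k j) = (if i = j then 1 else 0)"
    and vu: "\<And>k l. k \<in> B \<Longrightarrow> l \<in> B \<Longrightarrow> (\<Sum>i\<in>A. v k i * u i l) = (if k = l then 1 else 0)"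
    and orth: "\<And>i j k. i \<in> A \<Longrightarrow> j \<in> A \<Longrightarrow> k \<in> B \<Longrightarrow> i \<noteq> j \<Longrightarrow> u i k * u j k = 0"
  obtains s where "bij_betw s B A"
    and "\<And>i k. i \<in> A \<Longrightarrow> k \<in> B \<Longrightarrow> u i k = 0 \<longleftrightarrow> i \<noteq> s k"
    and "\<And>i k. i \<in> A \<Longrightarrow> k \<in> B \<Longrightarrow> v k i = 0 \<longleftrightarrow> i \<noteq> s k"
proof -
  have "\<exists>i\<in>A. u i k \<noteq> 0" if k: "k \<in> B" for k
  proof (rule ccontr)
    assume "\<not> (\<exists>i\<in>A. u i k \<noteq> 0)"
    then have "(\<Sum>i\<in>A. v k i * u i k) = 0" by (intro sum.neutral) auto
    then show False using vu[OF k k] by simp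
  qed
  then obtain s where s: "s k \<in> A" "u (s k) k \<noteq> 0" if "k \<in> B" for k by metis
  have u: "u i k = 0 \<longleftrightarrow> i \<noteq> s k" if "i \<in> A" "k \<in> B" for i k
    using orth[of i "s k" k] that s[of k] by auto
  have single: "v k (s l) * u (s l) l = (if k = l then 1 else 0)" if kl: "k \<in> B" "l \<in> B" for k l
  proof -
    have "(\<Sum>i\<in>A. v k i * u i l) = (\<Sum>i\<in>{s l}. v k i * u i l)"
      using s(1)[OF kl(2)] fin(1) u[OF _ kl(2)] by (intro sum.mono_neutral_right) auto
    then show ?thesis using vu[OF kl] by simp
  qed
  have vs: "v k (s k) \<noteq> 0" if "k \<in> B" for k
    using single[OF that that] by auto
  have v0: "v k (s l) = 0" if "k \<in> B" "l \<in> B" "k \<noteq> l" for k l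
    using single[OF that(1,2)] that(3) s(2)[OF that(2)] by simp
  have inj: "inj_on s B"
    by (rule inj_onI) (metis vs v0)
  have "\<exists>k\<in>B. i = s k" if i: "i \<in> A" for i
  proof (rule ccontr)
    assume "\<not> (\<exists>k\<in>B. i = s k)"
    then have "(\<Sum>k\<in>B. u i k * v k i) = 0" using u[OF i] by (intro sum.neutral) auto
    then show False using uv[OF i i] by simp
  qed
  then have bij: "bij_betw s B A" using inj s(1) by (auto simp: bij_betw_def)
  have "v k i = 0 \<longleftrightarrow> i \<noteq> s k" if "i \<in> A" "k \<in> B" for i k
    using that vs v0 bij_betw_imp_surj_on[OF bij] by (metis imageE)
  then show thesis using that[OF bij] u by blast
qed

section \<open>Representing an isomorphism of quotients by polynomials\<close>

text \<open>Calculations with cosets become congruences between polynomials. The condition \<open>kernel\<close> says that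
  the map induced by \<open>g\<close> on the quotients is well defined and injective, \<open>inverse\<close> that it is
  surjective with \<open>h\<close> choosing preimages of the variables, and \<open>bracket\<close> that it preserves
  brackets of variables.\<close>

locale lifted_poisson_iso =
  fixes n m :: nat and \<Lambda> \<Lambda>' :: "nat \<Rightarrow> nat \<Rightarrow> 'k::field" and M N :: "'k mpoly set"
    and g h :: "nat \<Rightarrow> 'k mpoly"
  assumes skew: "skew_matrix n \<Lambda>" "skew_matrix m \<Lambda>'"
    and graded: "graded_poisson_ideal M (skew_quadratic n \<Lambda>)" "graded_poisson_ideal N (skew_quadratic m \<Lambda>')"
    and M_ge: "M \<subseteq> polys_ge n 3" and N_ge: "N \<subseteq> polys_ge m 2"
    and g_polys: "\<And>i. i \<in> {1..n} \<Longrightarrow> g i \<in> polys m"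
    and h_polys: "\<And>k. k \<in> {1..m} \<Longrightarrow> h k \<in> polys n"
    and kernel: "\<And>p. p \<in> polys n \<Longrightarrow> substitute g p \<in> N \<longleftrightarrow> p \<in> M"
    and inverse: "\<And>k. k \<in> {1..m} \<Longrightarrow> substitute g (h k) - Var k \<in> N"
    and bracket: "\<And>i j. i \<in> {1..n} \<Longrightarrow> j \<in> {1..n} \<Longrightarrow>
      skew_bracket m \<Lambda>' (g i) (g j) - Const (\<Lambda> i j) * g i * g j \<in> N"

lemma poisson_iso_lift:
  fixes \<Lambda> \<Lambda>' :: "nat \<Rightarrow> nat \<Rightarrow> 'k::field"
  assumes skew: "skew_matrix n \<Lambda>" "skew_matrix m \<Lambda>'"
    and graded: "graded_poisson_ideal M (skew_quadratic n \<Lambda>)" "graded_poisson_ideal N (skew_quadratic m \<Lambda>')"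
    and ge: "M \<subseteq> polys_ge n 3" "N \<subseteq> polys_ge m 2"
    and F: "F \<in> poisson_iso scalars (skew_quadratic n \<Lambda> QuotP M) (skew_quadratic m \<Lambda>' QuotP N)"
  shows "\<exists>g h. lifted_poisson_iso n m \<Lambda> \<Lambda>' M N g h"
proof -
  let ?A = "skew_quadratic n \<Lambda>" and ?B = "skew_quadratic m \<Lambda>'"
  let ?a = "\<lambda>p. M +>\<^bsub>?A\<^esub> p" and ?b = "\<lambda>q. N +>\<^bsub>?B\<^esub> q"
  have pi: "poisson_ideal M ?A" "poisson_ideal N ?B"
    using graded by (simp_all add: graded_poisson_ideal_def)
  then have ids: "ideal M ?A" "ideal N ?B" by (simp_all add: poisson_ideal_def)
  interpret A: poisson_algebra scalars ?A by (rule skew_quadratic_poisson_algebra[OF skew(1)])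
  interpret B: poisson_algebra scalars ?B by (rule skew_quadratic_poisson_algebra[OF skew(2)])
  interpret MI: ideal M ?A by (rule ids)
  interpret NI: ideal N ?B by (rule ids)
  have carr: "carrier (?A QuotP M) = ?a ` polys n" "carrier (?B QuotP N) = ?b ` polys m"
    by (auto simp: poisson_quotient_def FactRing_def A_RCOSETS_def')
  have one: "\<one>\<^bsub>?A QuotP M\<^esub> = ?a 1" "\<one>\<^bsub>?B QuotP N\<^esub> = ?b 1"
    by (simp_all add: poisson_quotient_def FactRing_def)
  have addA: "?a p \<oplus>\<^bsub>?A QuotP M\<^esub> ?a q = ?a (p + q)" and multA: "?a p \<otimes>\<^bsub>?A QuotP M\<^esub> ?a q = ?a (p * q)"
    if "p \<in> polys n" "q \<in> polys n" for p q
    using that MI.a_rcos_sum[of p q] MI.rcoset_mult_add[of p q] by (simp_all add: poisson_quotient_def FactRing_def)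
  have addB: "?b p \<oplus>\<^bsub>?B QuotP N\<^esub> ?b q = ?b (p + q)" and multB: "?b p \<otimes>\<^bsub>?B QuotP N\<^esub> ?b q = ?b (p * q)"
    if "p \<in> polys m" "q \<in> polys m" for p q
    using that NI.a_rcos_sum[of p q] NI.rcoset_mult_add[of p q] by (simp_all add: poisson_quotient_def FactRing_def)
  have smultA: "c \<odot>\<^bsub>?A QuotP M\<^esub> ?a p = ?a (Const c * p)" if "p \<in> polys n" for c p
    using A.smult_coset[OF pi(1), of c p] that by simp
  have smultB: "c \<odot>\<^bsub>?B QuotP N\<^esub> ?b p = ?b (Const c * p)" if "p \<in> polys m" for c p
    using B.smult_coset[OF pi(2), of c p] that by simp
  have bracketA: "\<lbrace>?a p, ?a q\<rbrace>\<^bsub>?A QuotP M\<^esub> = ?a (skew_bracket n \<Lambda> p q)" if "p \<in> polys n" "q \<in> polys n" for p q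
    using A.bracket_coset[OF pi(1), of p q] that by simp
  have bracketB: "\<lbrace>?b p, ?b q\<rbrace>\<^bsub>?B QuotP N\<^esub> = ?b (skew_bracket m \<Lambda>' p q)" if "p \<in> polys m" "q \<in> polys m" for p q
    using B.bracket_coset[OF pi(2), of p q] that by simp
  have hom: "F \<in> ring_hom (?A QuotP M) (?B QuotP N)"
    and Fsmult: "\<And>c U. U \<in> carrier (?A QuotP M) \<Longrightarrow> F (c \<odot>\<^bsub>?A QuotP M\<^esub> U) = c \<odot>\<^bsub>?B QuotP N\<^esub> F U"
    and Fbracket: "\<And>U W. U \<in> carrier (?A QuotP M) \<Longrightarrow> W \<in> carrier (?A QuotP M) \<Longrightarrow>
        F \<lbrace>U, W\<rbrace>\<^bsub>?A QuotP M\<^esub> = \<lbrace>F U, F W\<rbrace>\<^bsub>?B QuotP N\<^esub>"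
    and bij: "bij_betw F (?a ` polys n) (?b ` polys m)"
    using F by (auto simp: poisson_iso_def poisson_hom_def carr)
  have "\<exists>q\<in>polys m. F (?a (Var i)) = ?b q" if "i \<in> {1..n}" for i
    using bij_betwE[OF bij] polys_Var[OF that] by blast
  then obtain g where g: "g i \<in> polys m" "F (?a (Var i)) = ?b (g i)" if "i \<in> {1..n}" for i
    by metis
  have sub: "substitute g p \<in> polys m" if "p \<in> polys n" for p
    using that g(1) by (rule substitute_in_polys)
  have Fsub: "F (?a p) = ?b (substitute g p)" if "p \<in> polys n" for p
    using that
  proof (induction rule: polys_induct)
    case (add p q)
    then have "F (?a (p + q)) = F (?a p) \<oplus>\<^bsub>?B QuotP N\<^esub> F (?a q)"
      using ring_hom_add[OF hom, of "?a p" "?a q"] by (simp add: carr addA)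
    then show ?case using add by (simp add: addB sub substitute_add)
  next
    case (Const c)
    have "F (?a (Const c)) = c \<odot>\<^bsub>?B QuotP N\<^esub> F (?a 1)"
      using Fsmult[of "?a 1" c] smultA[of 1 c] by (simp add: carr polys_closed)
    also have "F (?a 1) = ?b 1" using ring_hom_one[OF hom] by (simp add: one)
    finally show ?case using smultB[of 1 c] by (simp add: polys_closed)
  next
    case (Var i q)
    then have "F (?a (Var i * q)) = F (?a (Var i)) \<otimes>\<^bsub>?B QuotP N\<^esub> F (?a q)"
      using ring_hom_mult[OF hom, of "?a (Var i)" "?a q"] by (simp add: carr multA polys_Var)
    then show ?case using Var by (simp add: g multB sub substitute_mult)
  qed
  have eqA: "?a p = ?a q \<longleftrightarrow> p - q \<in> M" if "p \<in> polys n" "q \<in> polys n" for p q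
    by (rule coset_eq_iff[OF ids(1) that])
  have eqB: "?b p = ?b q \<longleftrightarrow> p - q \<in> N" if "p \<in> polys m" "q \<in> polys m" for p q
    by (rule coset_eq_iff[OF ids(2) that])
  have "\<exists>p\<in>polys n. F (?a p) = ?b (Var k)" if "k \<in> {1..m}" for k
    using bij_betw_imp_surj_on[OF bij] polys_Var[OF that] by (metis (no_types, lifting) imageE imageI)
  then obtain h where h: "h k \<in> polys n" "F (?a (h k)) = ?b (Var k)" if "k \<in> {1..m}" for k
    by metis
  have "lifted_poisson_iso n m \<Lambda> \<Lambda>' M N g h"
  proof (unfold_locales)
    fix p :: "'k mpoly" assume p: "p \<in> polys n"
    have "substitute g p \<in> N \<longleftrightarrow> F (?a p) = F (?a 0)"
      using eqB[of "substitute g p" 0] p by (simp add: Fsub sub polys_closed)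
    also have "\<dots> \<longleftrightarrow> ?a p = ?a 0"
      using bij_betw_imp_inj_on[OF bij] p by (intro inj_on_eq_iff) (auto simp: polys_closed)
    also have "\<dots> \<longleftrightarrow> p \<in> M" using eqA[of p 0] p by (simp add: polys_closed)
    finally show "substitute g p \<in> N \<longleftrightarrow> p \<in> M" .
  next
    fix k assume k: "k \<in> {1..m}"
    have "?b (substitute g (h k)) = ?b (Var k)" using h[OF k] Fsub by simp
    then show "substitute g (h k) - Var k \<in> N" using eqB[OF sub[OF h(1)[OF k]] polys_Var[OF k]] by blast
  next
    fix i j assume ij: "i \<in> {1..n}" "j \<in> {1..n}"
    note gij = g(1)[OF ij(1)] g(1)[OF ij(2)]
    have V: "(Var i :: 'k mpoly) \<in> polys n" "(Var j :: 'k mpoly) \<in> polys n"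
      using ij by (simp_all add: polys_Var)
    have "?b (skew_bracket m \<Lambda>' (g i) (g j)) = F (?a (skew_bracket n \<Lambda> (Var i) (Var j)))"
      using Fbracket[of "?a (Var i)" "?a (Var j)"] g(2)[OF ij(1)] g(2)[OF ij(2)] V gij
      by (simp add: carr bracketA bracketB)
    also have "\<dots> = ?b (Const (\<Lambda> i j) * g i * g j)"
      using Fsub[of "Const (\<Lambda> i j) * Var i * Var j"] V
      by (simp add: skew_bracket_Var[OF ij] polys_closed substitute_mult)
    finally show "skew_bracket m \<Lambda>' (g i) (g j) - Const (\<Lambda> i j) * g i * g j \<in> N"
      using gij by (simp add: eqB skew_bracket_in_polys polys_closed)
  qed (use skew graded ge g h in auto)
  then show ?thesis by blast
qed

section \<open>The origin corresponds to the origin\<close>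

context lifted_poisson_iso
begin

lemma ideals: "ideal M (skew_quadratic n \<Lambda>)" "ideal N (skew_quadratic m \<Lambda>')"
  using graded by (simp_all add: graded_poisson_ideal_def poisson_ideal_def)

lemma M_low: "p \<in> M \<Longrightarrow> d < 3 \<Longrightarrow> hom_part d p = 0"
  using M_ge polys_ge_order_ge[of p n 3] by (auto simp: order_ge_def)

lemma N_low: "p \<in> N \<Longrightarrow> d < 2 \<Longrightarrow> hom_part d p = 0"
  using N_ge polys_ge_order_ge[of p m 2] by (auto simp: order_ge_def)

lemma hom_part_product_eq_0:
  assumes "i \<in> {1..n}" "j \<in> {1..n}" "\<Lambda> i j \<noteq> 0" "d < 2"
  shows "hom_part d (g i * g j) = 0"
proof -
  have "hom_part d (Const (\<Lambda> i j) * (g i * g j)) = 0"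
    using N_low[OF bracket[OF assms(1,2)] assms(4)]
    by (simp add: hom_part_diff skew_bracket_low[OF assms(4)] mult.assoc)
  then show ?thesis using assms(3) by (simp add: hom_part_Const_mult)
qed

text \<open>If \<open>g s\<close> has a constant term, then every other \<open>g i\<close> vanishes at the origin to second order, so by
  the product rule the image of the tangent map is spanned by the linear part of \<open>g s\<close>.\<close>

lemma off_center_tangent:
  assumes nz: "\<And>i j. i \<in> {1..n} \<Longrightarrow> j \<in> {1..n} \<Longrightarrow> i \<noteq> j \<Longrightarrow> \<Lambda> i j \<noteq> 0"
    and s: "s \<in> {1..n}" "hom_part 0 (g s) \<noteq> 0"
    and p: "p \<in> polys n"
  shows "\<exists>c. hom_part 1 (substitute g p) = Const c * hom_part 1 (g s)"
proof -
  have 0: "hom_part 1 (g i) = 0" if i: "i \<in> {1..n}" "i \<noteq> s" for i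
  proof -
    have "\<Lambda> s i \<noteq> 0" using nz i s(1) by simp
    then have "hom_part 0 (g s * g i) = 0" "hom_part 1 (g s * g i) = 0"
      using hom_part_product_eq_0[OF s(1) i(1)] by simp_all
    then show ?thesis using s(2) unfolding hom_part_0_mult hom_part_1_mult by auto
  qed
  show ?thesis using p
  proof (induction rule: polys_induct)
    case (add p q)
    then obtain b c where "hom_part 1 (substitute g p) = Const b * hom_part 1 (g s)"
      "hom_part 1 (substitute g q) = Const c * hom_part 1 (g s)" by blast
    then show ?case by (intro exI[of _ "b + c"]) (simp only: substitute_add hom_part_add Const_simps distrib_right)
  next
    case (Const c)
    show ?case by (intro exI[of _ 0]) (simp add: hom_part_Const)
  next
    case (Var i q)
    then obtain c where c: "hom_part 1 (substitute g q) = Const c * hom_part 1 (g s)" by blast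
    have "\<exists>b. hom_part 1 (g i) = Const b * hom_part 1 (g s)"
    proof (cases "i = s")
      case True
      then show ?thesis by (intro exI[of _ 1]) (simp add: Const_simps)
    next
      case False
      then show ?thesis using 0[OF Var(1)] by (intro exI[of _ 0]) (simp add: Const_simps)
    qed
    then obtain b where b: "hom_part 1 (g i) = Const b * hom_part 1 (g s)" by blast
    let ?l = "\<lambda>p. Poly_Mapping.lookup p 0"
    show ?case
      by (intro exI[of _ "?l (g i) * c + b * ?l (substitute g q)"])
        (simp only: substitute_mult substitute_Var hom_part_1_mult hom_part_0 b c Const_simps, simp add: algebra_simps)
  qed
qed

text \<open>Every \<open>y\<^sub>k\<close> is the linear part of some \<open>substitute g p\<close> and hence a multiple of one linear form, so
  \<open>m \<le> 1\<close> and the bracket of \<open>P\<^sub>m\<close> is zero. A second index \<open>j\<close> would then give \<open>g s g j \<in> N\<close>, that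
  is \<open>x\<^sub>s x\<^sub>j \<in> M\<close>, against the degree bound on \<open>M\<close>.\<close>

lemma off_center_imp_n_eq_1:
  assumes nz: "\<And>i j. i \<in> {1..n} \<Longrightarrow> j \<in> {1..n} \<Longrightarrow> i \<noteq> j \<Longrightarrow> \<Lambda> i j \<noteq> 0"
    and s: "s \<in> {1..n}" "hom_part 0 (g s) \<noteq> 0"
  shows "n = 1"
proof (rule ccontr)
  assume "n \<noteq> 1"
  then have "{1..n} \<noteq> {s}" using s(1) by (metis atLeastatMost_empty_iff2 card_atLeastAtMost diff_Suc_1 is_singletonI is_singleton_altdef)
  then obtain j where j: "j \<in> {1..n}" "j \<noteq> s" using s(1) by blast
  have V: "\<exists>c. Var k = Const c * hom_part 1 (g s)" if k: "k \<in> {1..m}" for k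
  proof -
    have "hom_part 1 (substitute g (h k)) = hom_part 1 (Var k :: 'k mpoly)"
      using N_low[OF inverse[OF k], of 1] by (simp add: hom_part_diff)
    also have "\<dots> = Var k" by (simp add: hom_part_Var)
    finally show ?thesis using off_center_tangent[OF nz s h_polys[OF k]] by simp
  qed
  have "m \<le> 1"
  proof (rule ccontr)
    assume "\<not> m \<le> 1"
    then obtain b c where b: "Var 1 = Const b * hom_part 1 (g s)" and c: "Var 2 = Const c * hom_part 1 (g s)"
      using V[of 1] V[of 2] by auto
    have "Const c * Var 1 = Const b * (Var 2 :: 'k mpoly)" unfolding b c by (simp add: mult_ac)
    then have "Poly_Mapping.lookup (Const c * Var 1 :: 'k mpoly) (Poly_Mapping.single 1 1) =
      Poly_Mapping.lookup (Const b * Var 2 :: 'k mpoly) (Poly_Mapping.single 1 1)" by simp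
    then have "c = 0" by (simp add: lookup_Const_mult lookup_Var del: One_nat_def)
    then show False using c Var_neq_0[of 2, where 'k='k] by simp
  qed
  \<comment> \<open>With at most one variable, only a diagonal entry of \<open>\<Lambda>'\<close> enters the bracket.\<close>
  have "skew_bracket m \<Lambda>' (g s) (g j) = 0"
    unfolding skew_bracket_def
  proof (intro sum.neutral ballI)
    fix k l assume "k \<in> {1..m}" "l \<in> {1..m}"
    with \<open>m \<le> 1\<close> have "k = l" by simp
    then have "\<Lambda>' k l = 0" using skew(2) \<open>k \<in> {1..m}\<close> unfolding skew_matrix_def by blast
    then have "Const (\<Lambda>' k l) = 0" by simp
    then show "Const (\<Lambda>' k l) * Var k * Var l * partial k (g s) * partial l (g j) = 0"
      by (simp only: mult_zero_left)
  qed
  then have "- (Const (\<Lambda> s j) * g s * g j) \<in> N" using bracket[OF s(1) j(1)] by simp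
  then have "Const (\<Lambda> s j) * g s * g j \<in> N" using ideal_uminus[OF ideals(2)] by fastforce
  then have "substitute g (Const (\<Lambda> s j) * Var s * Var j) \<in> N" by (simp add: substitute_mult)
  then have "Const (\<Lambda> s j) * Var s * Var j \<in> M"
    using kernel s(1) j(1) by (simp add: polys_closed)
  then have "hom_part 2 (Const (\<Lambda> s j) * Var s * Var j) = 0" by (rule M_low) simp
  moreover have "order_ge 1 (Var i :: 'k mpoly)" for i by (simp add: order_ge_def hom_part_Var)
  then have "hom_part 2 (Var s * Var j :: 'k mpoly) = Var s * Var j"
    using order_ge_mult(2)[of 1 "Var s :: 'k mpoly" 1 "Var j"] by (simp add: hom_part_Var numeral_2_eq_2)
  ultimately show False using nz[OF s(1) j(1)] j(2) by (simp add: hom_part_Const_mult mult.assoc)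
qed

text \<open>A nonzero graded ideal of \<open>K[x]\<close> contains a power of \<open>x\<close>, whose image is the same power of \<open>g 1\<close>,
  with nonzero constant term; but it has to lie in \<open>N\<close>.\<close>

lemma off_center_imp_M_eq_0:
  assumes "n = 1" "hom_part 0 (g 1) \<noteq> 0" shows "M = {0}"
proof -
  have "p = 0" if p: "p \<in> M" for p
  proof (rule ccontr)
    assume "p \<noteq> 0"
    then obtain a where a: "a \<in> Poly_Mapping.keys p" by (metis keys_eq_empty equals0I)
    have pp: "p \<in> polys n" using ideal_in_polys[OF ideals(1) p] .
    have key: "b = Poly_Mapping.single 1 (mon_deg b)" if "b \<in> Poly_Mapping.keys p" for b
    proof -
      have "Poly_Mapping.keys b \<subseteq> {1}" using that pp assms(1) by (auto simp: polys_def)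
      then show ?thesis
        by (intro poly_mapping_eqI)
          (auto simp: mon_deg_superset[of "{1}"] lookup_single when_def in_keys_iff subset_iff)
    qed
    let ?c = "Poly_Mapping.lookup p a" and ?d = "mon_deg a"
    have "hom_part ?d p = Poly_Mapping.single a ?c"
    proof (rule poly_mapping_eqI)
      fix b
      have "b = a" if "b \<in> Poly_Mapping.keys p" "mon_deg b = ?d"
        using key[OF that(1)] key[OF a] that(2) by metis
      then show "Poly_Mapping.lookup (hom_part ?d p) b = Poly_Mapping.lookup (Poly_Mapping.single a ?c) b"
        by (auto simp: lookup_hom_part lookup_single when_def in_keys_iff)
    qed
    then have "Poly_Mapping.single a ?c \<in> M" using graded_ideal_hom_part[OF graded(1) p] by metis
    then have "substitute g (Poly_Mapping.single a ?c) \<in> N"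
      using kernel ideal_in_polys[OF ideals(1)] by blast
    also have "substitute g (Poly_Mapping.single a ?c) = Const ?c * g 1 ^ ?d"
      using key[OF a] mon_eval_single[of g 1 ?d] by (simp add: substitute_single)
    finally have "hom_part 0 (Const ?c * g 1 ^ ?d) = 0" by (rule N_low) simp
    moreover have "hom_part 0 (g 1 ^ e) = hom_part 0 (g 1) ^ e" for e
      by (induction e) (simp_all add: hom_part_0_mult hom_part_Const[of 0 1, unfolded Const_simps])
    ultimately show False using a assms(2) by (simp add: hom_part_Const_mult in_keys_iff)
  qed
  then show ?thesis using ideal_zero[OF ideals(1)] by blast
qed

text \<open>Only \<open>n = 1\<close> and \<open>M = 0\<close> can require a change of the lift. There \<open>P\<^sub>n/M\<close> is a polynomial ring in one
  variable with zero bracket, so it can be precomposed with a translation.\<close>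

lemma recenter:
  assumes nz: "\<And>i j. i \<in> {1..n} \<Longrightarrow> j \<in> {1..n} \<Longrightarrow> i \<noteq> j \<Longrightarrow> \<Lambda> i j \<noteq> 0"
  shows "\<exists>g h. lifted_poisson_iso n m \<Lambda> \<Lambda>' M N g h \<and> (\<forall>i\<in>{1..n}. hom_part 0 (g i) = 0)"
proof (cases "\<forall>i\<in>{1..n}. hom_part 0 (g i) = 0")
  case True
  then show ?thesis using lifted_poisson_iso_axioms by blast
next
  case False
  then obtain s where s: "s \<in> {1..n}" "hom_part 0 (g s) \<noteq> 0" by blast
  have n: "n = 1" by (rule off_center_imp_n_eq_1[OF nz s])
  have M: "M = {0}" using off_center_imp_M_eq_0 s n by simp
  \<comment> \<open>Precomposing with \<open>x \<mapsto> x - a\<close> removes the constant term of \<open>g 1\<close>; the inverse translation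
    corrects the preimages \<open>h k\<close>.\<close>
  define a where "a = Poly_Mapping.lookup (g 1) 0"
  let ?g = "\<lambda>i. g i - Const a" and ?h = "\<lambda>k. substitute (\<lambda>i. Var i + Const a) (h k)"
  have T: "substitute ?g p = substitute g (substitute (\<lambda>i. Var i - Const a) p)" if "p \<in> polys n" for p
    by (simp add: substitute_substitute[OF that] substitute_simps)
  have T_polys: "substitute (\<lambda>i. Var i - Const a) p \<in> polys n"
    "substitute (\<lambda>i. Var i + Const a) p \<in> polys n" if "p \<in> polys n" for p
  proof -
    have "Var i - Const a \<in> polys n" "Var i + Const a \<in> polys n" if "i \<in> {1..n}" for i
      using polys_add[OF polys_Var[OF that] polys_uminus[OF polys_basic(3)[of a]]]
        polys_add[OF polys_Var[OF that] polys_basic(3)[of a]] by simp_all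
    then show "substitute (\<lambda>i. Var i - Const a) p \<in> polys n"
      "substitute (\<lambda>i. Var i + Const a) p \<in> polys n"
      by (auto intro: substitute_in_polys[OF that])
  qed
  have inv: "substitute (\<lambda>i. Var i + Const a) (substitute (\<lambda>i. Var i - Const a) p) = p"
    "substitute (\<lambda>i. Var i - Const a) (substitute (\<lambda>i. Var i + Const a) p) = p" if "p \<in> polys n" for p
    by (simp_all add: substitute_substitute[OF that] substitute_simps substitute_Var_id[OF that])
  have "lifted_poisson_iso n m \<Lambda> \<Lambda>' M N ?g ?h"
  proof (unfold_locales)
    fix p :: "'k mpoly" assume p: "p \<in> polys n"
    have "substitute ?g p \<in> N \<longleftrightarrow> substitute (\<lambda>i. Var i - Const a) p = 0"
      using kernel[OF T_polys(1)[OF p]] by (simp add: T[OF p] M)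
    also have "\<dots> \<longleftrightarrow> p = 0" using inv(1)[OF p] by (metis substitute_zero)
    finally show "substitute ?g p \<in> N \<longleftrightarrow> p \<in> M" by (simp add: M)
  next
    fix k assume k: "k \<in> {1..m}"
    have "substitute ?g (?h k) = substitute g (h k)"
      using T[OF T_polys(2)[OF h_polys[OF k]]] inv(2)[OF h_polys[OF k]] by simp
    then show "substitute ?g (?h k) - Var k \<in> N" using inverse[OF k] by simp
  next
    fix i j assume "i \<in> {1..n}" "j \<in> {1..n}"
    then have ij: "i = 1" "j = 1" using n by auto
    have "\<Lambda> 1 1 = 0" using skew(1) n unfolding skew_matrix_def by simp
    then show "skew_bracket m \<Lambda>' (?g i) (?g j) - Const (\<Lambda> i j) * ?g i * ?g j \<in> N"
      using ij ideal_zero[OF ideals(2)] by (simp add: skew_bracket_self[OF skew(2)] Const_simps)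
  next
    show "?g i \<in> polys m" if "i \<in> {1..n}" for i
      using polys_add[OF g_polys[OF that] polys_uminus[OF polys_basic(3)[of a]]] by simp
  qed (use skew graded M_ge N_ge h_polys T_polys in auto)
  moreover have "\<forall>i\<in>{1..n}. hom_part 0 (?g i) = 0"
    using n by (simp add: hom_part_diff hom_part_Const hom_part_0 a_def)
  ultimately show ?thesis by blast
qed

end

section \<open>The tangent map\<close>

locale centered_poisson_iso = lifted_poisson_iso n m \<Lambda> \<Lambda>' M N g h
  for n m :: nat and \<Lambda> \<Lambda>' :: "nat \<Rightarrow> nat \<Rightarrow> 'k::field" and M N :: "'k mpoly set"
    and g h :: "nat \<Rightarrow> 'k mpoly" +
  assumes centered: "\<And>i. i \<in> {1..n} \<Longrightarrow> hom_part 0 (g i) = 0"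
    and nz: "\<And>i j. i \<in> {1..n} \<Longrightarrow> j \<in> {1..n} \<Longrightarrow> i \<noteq> j \<Longrightarrow> \<Lambda> i j \<noteq> 0"
begin

text \<open>The linear parts of the two lifts; substituting them gives the tangent maps \<open>L\<close> and \<open>L'\<close>.\<close>

abbreviation "dg \<equiv> \<lambda>i. hom_part 1 (g i)"
abbreviation "dh \<equiv> \<lambda>k. hom_part 1 (h k)"

lemma h_centered: "hom_part 0 (h k) = 0" if k: "k \<in> {1..m}"
proof -
  have "hom_part 0 (substitute g (h k)) = hom_part 0 (Var k :: 'k mpoly)"
    using N_low[OF inverse[OF k], of 0] by (simp add: hom_part_diff)
  moreover have "hom_part 0 (substitute g (h k)) = substitute dg (hom_part 0 (h k))"
    by (rule hom_part_substitute[OF h_polys[OF k] _ centered]) (auto simp: order_ge_def)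
  ultimately show ?thesis by (simp add: hom_part_0[of "h k"] hom_part_Var)
qed

lemma d_polys:
  "i \<in> {1..n} \<Longrightarrow> dg i \<in> polys m" "k \<in> {1..m} \<Longrightarrow> dh k \<in> polys n"
  by (rule hom_part_in_polys, erule g_polys) (rule hom_part_in_polys, erule h_polys)

lemma dg_dh: "substitute dg (dh k) = Var k" if k: "k \<in> {1..m}"
proof -
  have "substitute dg (dh k) = hom_part 1 (substitute g (h k))"
    using hom_part_substitute[OF h_polys[OF k], of 1 g] h_centered[OF k] centered by (simp add: order_ge_def)
  also have "\<dots> = hom_part 1 (Var k)"
    using N_low[OF inverse[OF k], of 1] by (simp add: hom_part_diff)
  finally show ?thesis by (simp add: hom_part_Var)
qed

lemma substitute_g_h: "substitute g (substitute h q) - q \<in> N" if "q \<in> polys m"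
  using that
proof (induction rule: polys_induct)
  case (add p q)
  have "substitute g (substitute h (p + q)) - (p + q) =
      (substitute g (substitute h p) - p) + (substitute g (substitute h q) - q)"
    by (simp add: substitute_add)
  then show ?case using ideal_add[OF ideals(2) add(3,4)] by (simp only:)
next
  case (Const c)
  show ?case using ideal_zero[OF ideals(2)] by simp
next
  case (Var k q)
  have polys: "substitute g (h k) \<in> polys m"
    using substitute_in_polys[OF h_polys[OF Var(1)] g_polys] .
  have "substitute g (substitute h (Var k * q)) - Var k * q =
      substitute g (h k) * (substitute g (substitute h q) - q) + q * (substitute g (h k) - Var k)"
    by (simp add: substitute_mult algebra_simps)
  then show ?case
    using ideal_add[OF ideals(2) ideal_mult[OF ideals(2) Var(3) polys]
        ideal_mult[OF ideals(2) inverse[OF Var(1)] Var(2)]] by simp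
qed

lemma substitute_h_in_polys: "q \<in> polys m \<Longrightarrow> substitute h q \<in> polys n"
  by (rule substitute_in_polys[OF _ h_polys])

text \<open>The condition \<open>kernel\<close> for \<open>h\<close> in place of \<open>g\<close>, by which the two directions become symmetric: \<open>g\<close>
  after \<open>h\<close> is the identity modulo \<open>N\<close>.\<close>

lemma kernel_h: "substitute h q \<in> M \<longleftrightarrow> q \<in> N" if "q \<in> polys m"
  using kernel[OF substitute_h_in_polys[OF that]] ideal_cong_iff[OF ideals(2) substitute_g_h[OF that]]
  by blast

lemma dh_dg: "substitute dh (dg i) = Var i" if i: "i \<in> {1..n}"
proof -
  have "substitute g (substitute h (g i) - Var i) \<in> N"
    using substitute_g_h[OF g_polys[OF i]] by (simp add: substitute_diff)
  moreover have "substitute h (g i) - Var i \<in> polys n"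
    using polys_add[OF substitute_h_in_polys[OF g_polys[OF i]] polys_uminus[OF polys_Var[OF i]]] by simp
  ultimately have "substitute h (g i) - Var i \<in> M" using kernel by blast
  then have "hom_part 1 (substitute h (g i)) = hom_part 1 (Var i)"
    using M_low[of _ 1] by (fastforce simp: hom_part_diff)
  moreover have "hom_part 1 (substitute h (g i)) = substitute dh (dg i)"
    using centered[OF i] by (intro hom_part_substitute[OF g_polys[OF i] _ h_centered]) (auto simp: order_ge_def)
  ultimately show ?thesis by (simp add: hom_part_Var)
qed

lemma linear_inverse:
  "p \<in> polys n \<Longrightarrow> substitute dh (substitute dg p) = p"
  "q \<in> polys m \<Longrightarrow> substitute dg (substitute dh q) = q"
  using substitute_Var_id[OF _ dh_dg] substitute_Var_id[OF _ dg_dh]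
  by (simp_all only: substitute_substitute)

lemma dg_ideal: "p \<in> M \<Longrightarrow> substitute dg p \<in> N"
  by (rule linear_part_maps_ideal[OF graded centered])
    (simp_all add: kernel ideal_in_polys[OF ideals(1)])

lemma dh_ideal: "q \<in> N \<Longrightarrow> substitute dh q \<in> M"
  by (rule linear_part_maps_ideal[OF graded(2,1) h_centered])
    (simp_all add: kernel_h ideal_in_polys[OF ideals(2)])

lemma dh_image: "substitute dh ` N = M"
proof
  show "M \<subseteq> substitute dh ` N"
  proof
    fix p assume p: "p \<in> M"
    then have "p = substitute dh (substitute dg p)"
      using linear_inverse(1) ideal_in_polys[OF ideals(1)] by metis
    then show "p \<in> substitute dh ` N" using dg_ideal[OF p] by blast
  qed
qed (use dh_ideal in auto)

text \<open>The degree two component of the congruence \<open>bracket\<close> is an element of \<open>N\<close>, and \<open>dh\<close> maps it to a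
  quadratic element of \<open>M\<close>, that is to zero. As \<open>dh\<close> is injective, the congruence between
  linear parts is an equation.\<close>

lemma dg_bracket: "skew_bracket m \<Lambda>' (dg i) (dg j) = Const (\<Lambda> i j) * dg i * dg j"
  if ij: "i \<in> {1..n}" "j \<in> {1..n}"
proof -
  let ?r = "\<lambda>p q. skew_bracket m \<Lambda>' p q - Const (\<Lambda> i j) * p * q"
  have ord: "order_ge 1 (g i)" "order_ge 1 (g j)" using centered ij by (simp_all add: order_ge_def)
  have two: "{..2::nat} = {0,1,2}" by auto
  have "hom_part 2 (skew_bracket m \<Lambda>' (g i) (g j)) = skew_bracket m \<Lambda>' (dg i) (dg j)"
    using skew_bracket_Const_left[of m \<Lambda>' 0] skew_bracket_Const[of m \<Lambda>' _ 0]
    by (simp add: hom_part_bracket two centered[OF ij(1)] centered[OF ij(2)] Const_simps)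
  moreover have "hom_part 2 (g i * g j) = dg i * dg j"
    using order_ge_mult(2)[OF ord] by (simp only: one_add_one)
  ultimately have part: "hom_part 2 (?r (g i) (g j)) = ?r (dg i) (dg j)"
    by (simp add: hom_part_diff hom_part_Const_mult mult.assoc)
  then have N: "?r (dg i) (dg j) \<in> N"
    using graded_ideal_hom_part[OF graded(2) bracket[OF ij], of 2] by simp
  then have polys: "?r (dg i) (dg j) \<in> polys m" by (rule ideal_in_polys[OF ideals(2)])
  have hom: "hom_part 2 (?r (dg i) (dg j)) = ?r (dg i) (dg j)"
    unfolding part[symmetric] by (simp add: hom_part_hom_part)
  have "substitute dh (?r (dg i) (dg j)) = hom_part 2 (substitute dh (?r (dg i) (dg j)))"
    by (rule hom_part_substitute_linear[OF polys hom, symmetric]) (simp add: hom_part_hom_part)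
  also have "\<dots> = 0" by (rule M_low[OF dh_ideal[OF N]]) simp
  finally have "?r (dg i) (dg j) = 0" using linear_inverse(2)[OF polys] by (metis substitute_zero)
  then show ?thesis by simp
qed

text \<open>The matrices of \<open>dg\<close> and \<open>dh\<close> are mutually inverse. Restricting \<open>dg_bracket\<close> to the \<open>k\<close>-th axis
  gives \<open>0 = \<lambda>\<^sub>i\<^sub>j u\<^sub>i\<^sub>k u\<^sub>j\<^sub>k y\<^sub>k\<^sup>2\<close>, where \<open>u\<close> is the matrix of \<open>dg\<close>; so it is monomial because the
  \<open>\<lambda>\<^sub>i\<^sub>j\<close> with \<open>i \<noteq> j\<close> are nonzero.\<close>

lemma dg_dh_monomial:
  obtains s u v where "bij_betw s {1..m} {1..n}"
    "\<And>k. k \<in> {1..m} \<Longrightarrow> u k \<noteq> 0" "\<And>k. k \<in> {1..m} \<Longrightarrow> v k \<noteq> 0"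
    "\<And>k. k \<in> {1..m} \<Longrightarrow> dg (s k) = Const (u k) * Var k"
    "\<And>k. k \<in> {1..m} \<Longrightarrow> dh k = Const (v k) * Var (s k)"
proof -
  define u where "u i k = Poly_Mapping.lookup (g i) (Poly_Mapping.single k 1)" for i k
  define v where "v k i = Poly_Mapping.lookup (h k) (Poly_Mapping.single i 1)" for i k
  have dg: "dg i = (\<Sum>k\<in>{1..m}. Const (u i k) * Var k)" if "i \<in> {1..n}" for i
    unfolding u_def by (rule hom_part_1_eq[OF g_polys[OF that]])
  have dh: "dh k = (\<Sum>i\<in>{1..n}. Const (v k i) * Var i)" if "k \<in> {1..m}" for k
    unfolding v_def by (rule hom_part_1_eq[OF h_polys[OF that]])
  have coeff_g: "Poly_Mapping.lookup (dg i) (Poly_Mapping.single k 1) = u i k" for i k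
    unfolding u_def lookup_hom_part by simp
  have coeff_h: "Poly_Mapping.lookup (dh k) (Poly_Mapping.single i 1) = v k i" for i k
    unfolding v_def lookup_hom_part by simp
  have uv: "(\<Sum>k\<in>{1..m}. u i k * v k j) = (if i = j then 1 else 0)" if "i \<in> {1..n}" for i j
  proof -
    have "Var i = (\<Sum>k\<in>{1..m}. Const (u i k) * dh k)"
      using dh_dg[OF that] unfolding dg[OF that] by (simp add: substitute_sum substitute_mult)
    then have "Poly_Mapping.lookup (Var i) (Poly_Mapping.single j 1) = (\<Sum>k\<in>{1..m}. u i k * v k j)"
      by (simp only: lookup_sum lookup_Const_mult coeff_h)
    then show ?thesis by (simp only: lookup_Var)
  qed
  have vu: "(\<Sum>i\<in>{1..n}. v k i * u i l) = (if k = l then 1 else 0)" if "k \<in> {1..m}" for k l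
  proof -
    have "Var k = (\<Sum>i\<in>{1..n}. Const (v k i) * dg i)"
      using dg_dh[OF that] unfolding dh[OF that] by (simp add: substitute_sum substitute_mult)
    then have "Poly_Mapping.lookup (Var k) (Poly_Mapping.single l 1) = (\<Sum>i\<in>{1..n}. v k i * u i l)"
      by (simp only: lookup_sum lookup_Const_mult coeff_g)
    then show ?thesis by (simp only: lookup_Var)
  qed
  have orth: "u i k * u j k = 0" if ij: "i \<in> {1..n}" "j \<in> {1..n}" and k: "k \<in> {1..m}" and ne: "i \<noteq> j" for i j k
  proof -
    \<comment> \<open>Restriction to the \<open>k\<close>-th coordinate axis.\<close>
    let ?e = "substitute (\<lambda>l. if l = k then Var k else 0)"
    have e: "?e (dg i) = Const (u i k) * Var k" if i: "i \<in> {1..n}" for i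
    proof -
      have "?e (dg i) = (\<Sum>l\<in>{1..m}. if l = k then Const (u i k) * Var k else 0)"
        unfolding dg[OF i] substitute_sum by (intro sum.cong refl) (simp add: substitute_mult)
      then show ?thesis using k by simp
    qed
    have "0 = ?e (Const (\<Lambda> i j) * dg i * dg j)"
      unfolding dg_bracket[OF ij, symmetric] by (rule substitute_axis_bracket[OF skew(2), symmetric])
    then have "Const (\<Lambda> i j) * (Const (u i k) * Var k) * (Const (u j k) * Var k) = 0"
      by (simp only: substitute_mult substitute_Const e[OF ij(1)] e[OF ij(2)])
    then show ?thesis using nz[OF ij ne] by simp
  qed
  obtain s where s: "bij_betw s {1..m} {1..n}"
    and us: "\<And>i k. i \<in> {1..n} \<Longrightarrow> k \<in> {1..m} \<Longrightarrow> u i k = 0 \<longleftrightarrow> i \<noteq> s k"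
    and vs: "\<And>i k. i \<in> {1..n} \<Longrightarrow> k \<in> {1..m} \<Longrightarrow> v k i = 0 \<longleftrightarrow> i \<noteq> s k"
  proof (rule monomial_matrix[of "{1..n}" "{1..m}" u v])
    show "u i k * u j k = 0" if "i \<in> {1..n}" "j \<in> {1..n}" "k \<in> {1..m}" "i \<noteq> j" for i j k
      using that by (rule orth)
  qed (use that uv vu in simp_all)
  have sn: "s k \<in> {1..n}" if "k \<in> {1..m}" for k using bij_betwE[OF s] that by blast
  show thesis
  proof (rule that[OF s])
    fix k assume k: "k \<in> {1..m}"
    show "u (s k) k \<noteq> 0" "v k (s k) \<noteq> 0" using us[OF sn[OF k] k] vs[OF sn[OF k] k] by simp_all
    have "u (s k) l = 0" if "l \<in> {1..m}" "l \<noteq> k" for l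
      using us[OF sn[OF k] that(1)] bij_betw_imp_inj_on[OF s] that k by (auto dest: inj_onD)
    then have "dg (s k) = (\<Sum>l\<in>{1..m}. if l = k then Const (u (s k) k) * Var k else 0)"
      unfolding dg[OF sn[OF k]] by (intro sum.cong refl) auto
    then show "dg (s k) = Const (u (s k) k) * Var k" using k by simp
    have "dh k = (\<Sum>i\<in>{1..n}. if i = s k then Const (v k (s k)) * Var (s k) else 0)"
      unfolding dh[OF k] using vs[OF _ k] by (intro sum.cong refl) auto
    then show "dh k = Const (v k (s k)) * Var (s k)" using sn[OF k] by simp
  qed
qed

lemma lambda_permuted:
  assumes s: "bij_betw s {1..m} {1..n}"
    and u: "\<And>k. k \<in> {1..m} \<Longrightarrow> u k \<noteq> 0" "\<And>k. k \<in> {1..m} \<Longrightarrow> dg (s k) = Const (u k) * Var k"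
    and kl: "k \<in> {1..m}" "l \<in> {1..m}"
  shows "\<Lambda>' k l = \<Lambda> (s k) (s l)"
proof -
  have sk: "s k \<in> {1..n}" "s l \<in> {1..n}" using bij_betwE[OF s] kl by blast+
  have "Const (u k) * (Const (u l) * (Const (\<Lambda>' k l) * Var k * Var l)) =
      Const (\<Lambda> (s k) (s l)) * (Const (u k) * Var k) * (Const (u l) * Var l)"
    using dg_bracket[OF sk] unfolding u(2)[OF kl(1)] u(2)[OF kl(2)] skew_bracket_Const_mult skew_bracket_Var[OF kl]
    by (simp only: mult.left_commute)
  then have "(Const (\<Lambda>' k l) - Const (\<Lambda> (s k) (s l))) * (Const (u k) * Const (u l) * Var k * Var l) = 0"
    by (simp add: algebra_simps)
  then have "Const (\<Lambda>' k l) = Const (\<Lambda> (s k) (s l))" using u(1) kl by simp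
  then show ?thesis by (simp add: Const_def) (metis lookup_single_eq)
qed

text \<open>The isomorphism is the substitution of \<open>dh\<close>: it is inverted by that of \<open>dg\<close>, carries \<open>N\<close> onto \<open>M\<close>,
  and preserves brackets because \<open>\<Lambda>\<close> and \<open>\<Lambda>'\<close> agree up to the permutation of the variables.\<close>

lemma graded_iso_permutes_variables:
  "n = m \<and>
    (\<exists>\<sigma>. \<sigma> permutes {1..n} \<and> (\<forall>i\<in>{1..n}. \<forall>j\<in>{1..n}. \<Lambda> i j = \<Lambda>' (\<sigma> i) (\<sigma> j))) \<and>
    (\<exists>\<tau> c \<phi>. \<tau> permutes {1..n} \<and> (\<forall>i\<in>{1..n}. c i \<noteq> 0) \<and>
       \<phi> \<in> poisson_iso scalars (skew_quadratic n \<Lambda>') (skew_quadratic n \<Lambda>) \<and>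
       (\<forall>i\<in>{1..n}. \<phi> (Var i) = Const (c i) * Var (\<tau> i)) \<and>
       \<phi> ` N = M)"
proof -
  obtain s u v where s: "bij_betw s {1..m} {1..n}"
    and u: "\<And>k. k \<in> {1..m} \<Longrightarrow> u k \<noteq> 0" "\<And>k. k \<in> {1..m} \<Longrightarrow> dg (s k) = Const (u k) * Var k"
    and v: "\<And>k. k \<in> {1..m} \<Longrightarrow> v k \<noteq> 0" "\<And>k. k \<in> {1..m} \<Longrightarrow> dh k = Const (v k) * Var (s k)"
    using dg_dh_monomial by metis
  have nm: "m = n" using bij_betw_same_card[OF s] by simp
  define \<tau> where "\<tau> k = (if k \<in> {1..n} then s k else k)" for k
  have \<tau>: "\<tau> permutes {1..n}"
  proof (rule bij_imp_permutes)
    have "bij_betw \<tau> {1..n} {1..n} \<longleftrightarrow> bij_betw s {1..n} {1..n}"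
      by (rule bij_betw_cong) (simp add: \<tau>_def)
    then show "bij_betw \<tau> {1..n} {1..n}" using s nm by simp
  qed (auto simp: \<tau>_def)
  define \<tau>' where "\<tau>' = inv_into UNIV \<tau>"
  have lam: "\<Lambda>' k l = \<Lambda> (\<tau> k) (\<tau> l)" if "k \<in> {1..n}" "l \<in> {1..n}" for k l
    using lambda_permuted[OF s u] that by (simp add: nm \<tau>_def)
  let ?\<phi> = "substitute dh"
  have closed: "?\<phi> p \<in> polys n" if "p \<in> polys n" for p
    using substitute_in_polys[OF that[folded nm] d_polys(2)] .
  have "?\<phi> \<in> poisson_iso scalars (skew_quadratic n \<Lambda>') (skew_quadratic n \<Lambda>)"
    unfolding poisson_iso_def poisson_hom_def
  proof (intro CollectI conjI ballI)
    show "?\<phi> \<in> ring_hom (skew_quadratic n \<Lambda>') (skew_quadratic n \<Lambda>)"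
      by (rule ring_hom_memI) (simp_all add: closed substitute_simps del: One_nat_def)
    have "skew_bracket n \<Lambda> (dh i) (dh j) = Const (\<Lambda>' i j) * dh i * dh j"
      if ij: "i \<in> {1..n}" "j \<in> {1..n}" for i j
    proof -
      have t: "\<tau> i \<in> {1..n}" "\<tau> j \<in> {1..n}" using permutes_in_image[OF \<tau>] ij by auto
      have "dh k = Const (v k) * Var (\<tau> k)" if "k \<in> {1..n}" for k
        using v(2)[of k] that by (simp add: nm \<tau>_def)
      then show ?thesis using ij
        by (simp only: skew_bracket_Const_mult skew_bracket_Var[OF t] lam[OF ij] mult_ac)
    qed
    then show "?\<phi> \<lbrace>p, q\<rbrace>\<^bsub>skew_quadratic n \<Lambda>'\<^esub> = \<lbrace>?\<phi> p, ?\<phi> q\<rbrace>\<^bsub>skew_quadratic n \<Lambda>\<^esub>"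
      if "p \<in> carrier (skew_quadratic n \<Lambda>')" "q \<in> carrier (skew_quadratic n \<Lambda>')" for p q
      using substitute_bracket[of n \<Lambda>' n \<Lambda> dh p q] skew that by (simp add: nm)
    show "bij_betw ?\<phi> (carrier (skew_quadratic n \<Lambda>')) (carrier (skew_quadratic n \<Lambda>))"
      by (rule bij_betw_byWitness[where f' = "substitute dg"])
        (use linear_inverse closed substitute_in_polys[OF _ d_polys(1)] in \<open>auto simp: nm simp del: One_nat_def\<close>)
  qed (simp_all add: substitute_mult)
  moreover have "\<forall>k\<in>{1..n}. ?\<phi> (Var k) = Const (v k) * Var (\<tau> k)"
    using v(2) by (simp add: nm \<tau>_def)
  moreover have \<tau>': "\<tau>' permutes {1..n}" unfolding \<tau>'_def by (rule permutes_inv[OF \<tau>])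
  moreover have "\<forall>i\<in>{1..n}. \<forall>j\<in>{1..n}. \<Lambda> i j = \<Lambda>' (\<tau>' i) (\<tau>' j)"
    using lam permutes_in_image[OF \<tau>'] permutes_inverses(1)[OF \<tau>] by (simp add: \<tau>'_def)
  ultimately show ?thesis using nm \<tau> \<tau>' v(1) dh_image by blast
qed

end

theorem theorem4p6:
  fixes \<Lambda> \<Lambda>' :: "nat \<Rightarrow> nat \<Rightarrow> 'k::field"
    and n m :: nat
    and M N :: "'k mpoly set"
  assumes "skew_matrix n \<Lambda>"
    and "\<forall>i\<in>{1..n}. \<forall>j\<in>{1..n}. i \<noteq> j \<longrightarrow> \<Lambda> i j \<noteq> 0"
    and "graded_poisson_ideal M (skew_quadratic n \<Lambda>)"
    and "M \<subseteq> polys_ge n 3"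
    and "skew_matrix m \<Lambda>'"
    and "graded_poisson_ideal N (skew_quadratic m \<Lambda>')"
    and "N \<subseteq> polys_ge m 2"
    and "poisson_iso scalars (skew_quadratic n \<Lambda> QuotP M) (skew_quadratic m \<Lambda>' QuotP N) \<noteq> {}"
  shows "n = m \<and>
    (\<exists>\<sigma>. \<sigma> permutes {1..n} \<and> (\<forall>i\<in>{1..n}. \<forall>j\<in>{1..n}. \<Lambda> i j = \<Lambda>' (\<sigma> i) (\<sigma> j))) \<and>
    (\<exists>\<tau> c \<phi>. \<tau> permutes {1..n} \<and> (\<forall>i\<in>{1..n}. c i \<noteq> 0) \<and>
       \<phi> \<in> poisson_iso scalars (skew_quadratic n \<Lambda>') (skew_quadratic n \<Lambda>) \<and>
       (\<forall>i\<in>{1..n}. \<phi> (Var i) = Const (c i) * Var (\<tau> i)) \<and>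
       \<phi> ` N = M)"
proof -
  have nz: "\<Lambda> i j \<noteq> 0" if "i \<in> {1..n}" "j \<in> {1..n}" "i \<noteq> j" for i j
    using assms(2) that by blast
  obtain g\<^sub>0 h\<^sub>0 where lift: "lifted_poisson_iso n m \<Lambda> \<Lambda>' M N g\<^sub>0 h\<^sub>0"
    using assms(8) poisson_iso_lift[OF assms(1,5,3,6,4,7)] by blast
  obtain g h where "lifted_poisson_iso n m \<Lambda> \<Lambda>' M N g h" "\<forall>i\<in>{1..n}. hom_part 0 (g i) = 0"
    using lifted_poisson_iso.recenter[OF lift nz] by blast
  then have "centered_poisson_iso n m \<Lambda> \<Lambda>' M N g h"
    using nz by (simp add: centered_poisson_iso_def centered_poisson_iso_axioms_def)
  then show ?thesis by (rule centered_poisson_iso.graded_iso_permutes_variables)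
qed

end
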